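(* Let $L>2r^*+3$. Then $\mathcal X^m=\{\square\}$ and $\mathcal X^s=\{\blacksquare\}$, where $\square$ denotes the empty configuration and $\blacksquare$ denotes the configuration that is full in $\Lambda^-$ and empty in $\Lambda\setminus\Lambda^-$. Moreover, $\Gamma_m=\Phi(\square,\blacksquare)=\Gamma^{\text{K-Hex}}$.
   Context: Model. $\mathbb H^2$ is the discrete hexagonal lattice, with dual the triangular lattice $\mathbb T^2$; each site of $\mathbb H^2$ is the center of a triangular face of $\mathbb T^2$ (edge length of $\mathbb{T}^2$ taken as unit of length), two sites are nearest neighbors if they share an edge of $\mathbb H^2$, and $|x-y|$ is the lattice distance. Fix an integer $L\ge 1$ and a regular hexagon of radius (side length) $L$ with sides along $\mathbb T^2$; it contains $6L^2$ sites. $\Lambda\subset\mathbb H^2$ is the union of this hexagon and all sites not in it at lattice distance one from it. Put $\partial^-\Lambda=\{x\in\Lambda:\exists y\notin\Lambda,\ |y-x|=1\}$ and $\Lambda^-=\Lambda\setminus\partial^-\Lambda$ (so $\Lambda^-$ is the hexagon of radius $L$). Configurations: $\eta\in\mathcal X=\{0,1\}^\Lambda$ ($\eta(x)=1$: occupied by a particle). Hamiltonian: $H(\eta)=-U\sum_{\{x,y\}}\eta(x)\eta(y)+\Delta\sum_{x\in\Lambda}\eta(x)$, the first sum over unordered nearest-neighbor pairs in $\Lambda^-$. Kawasaki dynamics. Let $\bar\Lambda^{*,orie}$ be the set of oriented nearest-neighbor bonds $(x\to y)$ with $x,y\in\Lambda$, or $x\in\partial^-\Lambda,y\notin\Lambda$,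 or $x\notin\Lambda,y\in\partial^-\Lambda$. $T_b\eta$ is obtained from $\eta$ by exchanging the values at $x,y$ (first case), setting $\eta(x)=0$ (second case), setting $\eta(y)=1$ (third case). The discrete-time Markov chain has, for $\eta\ne\eta'$, $P(\eta,\eta')=|\bar\Lambda^{*,orie}|^{-1}e^{-\beta[H(\eta')-H(\eta)]_+}$ if $\eta'=T_b\eta$ for some $b\in\bar\Lambda^{*,orie}$, and $0$ otherwise; $P(\eta,\eta)=1-\sum_{\eta'\ne\eta}P(\eta,\eta')$. Standing assumptions. $U>0$, $\Delta\in(U,\frac32U)$, $3U-2\Delta\ll U$ (it is enough that $3U-2\Delta\le U/100$), $\frac{U}{2(3U-2\Delta)}-\frac12$ is not an integer. The critical radius is $r^*=\lfloor\frac{U}{2(3U-2\Delta)}-\frac12\rfloor$ and $\delta\in(0,1)$ is the fractional part of $\frac{U}{2(3U-2\Delta)}-\frac12$; $\delta\neq\frac12$. $\Gamma^{\text{K-Hex}}=\Gamma_1^*$ if $\delta\in(0,\frac12)$ and $\Gamma_2^*$ if $\delta\in(\frac12,1)$, where $\Gamma_1^*=-3(3(r^* )^2-r^* )U+6(r^* )^2\Delta+5(2r^*+1)\Delta-(15r^*+4)U+\Delta$ and $\Gamma_2^*=-3(3(r^*+1)^2-(r^*+1))U+6(r^*+1)^2\Delta+(2r^*+3)\Delta-3(r^*+1)U+\Delta$. Metastability notions. A path is a sequence $\omega=(\omega_1,\dots,\omega_k)$ in $\mathcal X$ with $P(\omega_i,\omega_{i+1})>0$. Communication height: $\Phi(\sigma,\eta)=\min_{\omega:\sigma\to\eta}\max_{\zeta\in\omega}H(\zeta)$,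 and $\Phi(\sigma,\mathcal A)=\min_{\eta\in\mathcal A}\Phi(\sigma,\eta)$. Stability level: $V_\sigma=\Phi(\sigma,\mathcal I_\sigma)-H(\sigma)$ with $\mathcal I_\sigma=\{\eta:H(\eta)<H(\sigma)\}$, and $V_\sigma=\infty$ if $\mathcal I_\sigma=\emptyset$. $\mathcal X^s$ is the set of global minimizers of $H$ (stable states). $\mathcal X^m=\{\sigma:V_\sigma=\max_{\eta\in\mathcal X\setminus\mathcal X^s}V_\eta\}$ (metastable states), and $\Gamma_m$ is the stability level of the states in $\mathcal X^m$. Here $\square(x)=0$ for all $x\in\Lambda$ (so $H(\square)=0$); $\blacksquare(x)=1$ for $x\in\Lambda^-$ and $\blacksquare(x)=0$ for $x\in\Lambda\setminus\Lambda^-$. In this text the symbol $\square$ always stands for this empty configuration. *)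

theory Defs
  imports Complex_Main "HOL-Library.FuncSet" "HOL-Library.Extended_Real"
begin

section \<open>Energy landscapes\<close>

text \<open>
  A finite state space \<open>X\<close>, a transition function \<open>P\<close> and an energy \<open>H\<close>. All minima and maxima
  below are over sets of finitely many values, because \<open>X\<close> is finite.
\<close>

definition paths :: "'c set \<Rightarrow> ('c \<Rightarrow> 'c \<Rightarrow> real) \<Rightarrow> 'c \<Rightarrow> 'c \<Rightarrow> 'c list set" where
  "paths X P \<sigma> \<eta> =
     {\<omega>. \<omega> \<noteq> [] \<and> set \<omega> \<subseteq> X \<and> successively (\<lambda>\<zeta> \<zeta>'. P \<zeta> \<zeta>' > 0) \<omega> \<and> hd \<omega> = \<sigma> \<and> last \<omega> = \<eta>}"

definition comm_height ::
    "'c set \<Rightarrow> ('c \<Rightarrow> 'c \<Rightarrow> real) \<Rightarrow> ('c \<Rightarrow> real) \<Rightarrow> 'c \<Rightarrow> 'c \<Rightarrow> real" where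
  "comm_height X P H \<sigma> \<eta> = Min ((\<lambda>\<omega>. Max (H ` set \<omega>)) ` paths X P \<sigma> \<eta>)"

definition comm_height_set ::
    "'c set \<Rightarrow> ('c \<Rightarrow> 'c \<Rightarrow> real) \<Rightarrow> ('c \<Rightarrow> real) \<Rightarrow> 'c \<Rightarrow> 'c set \<Rightarrow> real" where
  "comm_height_set X P H \<sigma> A = Min (comm_height X P H \<sigma> ` A)"

definition lower_energy :: "'c set \<Rightarrow> ('c \<Rightarrow> real) \<Rightarrow> 'c \<Rightarrow> 'c set" where
  "lower_energy X H \<sigma> = {\<eta> \<in> X. H \<eta> < H \<sigma>}"

definition stability_level ::
    "'c set \<Rightarrow> ('c \<Rightarrow> 'c \<Rightarrow> real) \<Rightarrow> ('c \<Rightarrow> real) \<Rightarrow> 'c \<Rightarrow> ereal" where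
  "stability_level X P H \<sigma> =
     (if lower_energy X H \<sigma> = {} then \<infinity>
      else ereal (comm_height_set X P H \<sigma> (lower_energy X H \<sigma>) - H \<sigma>))"

definition stable_states :: "'c set \<Rightarrow> ('c \<Rightarrow> real) \<Rightarrow> 'c set" where
  "stable_states X H = {\<sigma> \<in> X. \<forall>\<eta>\<in>X. H \<sigma> \<le> H \<eta>}"

definition metastable_states ::
    "'c set \<Rightarrow> ('c \<Rightarrow> 'c \<Rightarrow> real) \<Rightarrow> ('c \<Rightarrow> real) \<Rightarrow> 'c set" where
  "metastable_states X P H =
     {\<sigma> \<in> X. stability_level X P H \<sigma> = Max (stability_level X P H ` (X - stable_states X H))}"

text \<open>The common stability level of the metastable states.\<close>

definition metastable_level ::
    "'c set \<Rightarrow> ('c \<Rightarrow> 'c \<Rightarrow> real) \<Rightarrow> ('c \<Rightarrow> real) \<Rightarrow> ereal" where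
  "metastable_level X P H = (THE v. stability_level X P H ` metastable_states X P H = {v})"


section \<open>The hexagonal lattice\<close>

text \<open>
  The vertex \<open>a e\<^sub>1 + b e\<^sub>2\<close> of the triangular lattice, with \<open>e\<^sub>1 = (1, 0)\<close> and
  \<open>e\<^sub>2 = (1/2, sqrt 3/2)\<close>, is written \<open>(a, b)\<close>. A site of the hexagonal lattice is identified with
  the triangular face of which it is the center; \<open>Up a b\<close> and \<open>Down a b\<close> are the two faces into
  which the rhombus with corners \<open>(a, b)\<close>, \<open>(a + 1, b)\<close>, \<open>(a + 1, b + 1)\<close>, \<open>(a, b + 1)\<close> is cut.
\<close>

datatype site = Up int int | Down int int

fun corners :: "site \<Rightarrow> (int \<times> int) set" where
  "corners (Up a b) = {(a, b), (a + 1, b), (a, b + 1)}"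
| "corners (Down a b) = {(a + 1, b), (a, b + 1), (a + 1, b + 1)}"

text \<open>
  An edge of the hexagonal lattice joins the centers of two triangular faces with a common side,
  i.e. with exactly two common corners.
\<close>

definition nn :: "site \<Rightarrow> site \<Rightarrow> bool" where
  "nn x y \<longleftrightarrow> card (corners x \<inter> corners y) = 2"

definition lattice_dist :: "site \<Rightarrow> site \<Rightarrow> nat" where
  "lattice_dist x y = (LEAST n. (x, y) \<in> {(u, v). nn u v} ^^ n)"

text \<open>
  The regular hexagon of side length \<open>L\<close> centered at the vertex \<open>(0, 0)\<close>: in the coordinates above
  its sides lie on the lines \<open>\<bar>a\<bar> = L\<close>, \<open>\<bar>b\<bar> = L\<close> and \<open>\<bar>a + b\<bar> = L\<close>.
\<close>

definition hexagon :: "nat \<Rightarrow> site set" where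
  "hexagon L =
     {x. corners x \<subseteq> {(a, b). \<bar>a\<bar> \<le> int L \<and> \<bar>b\<bar> \<le> int L \<and> \<bar>a + b\<bar> \<le> int L}}"

definition Box :: "nat \<Rightarrow> site set" where
  "Box L = hexagon L \<union> {x. x \<notin> hexagon L \<and> (\<exists>y\<in>hexagon L. lattice_dist x y = 1)}"

definition Box_bd :: "nat \<Rightarrow> site set" where
  "Box_bd L = {x \<in> Box L. \<exists>y. y \<notin> Box L \<and> lattice_dist y x = 1}"

definition Box_int :: "nat \<Rightarrow> site set" where
  "Box_int L = Box L - Box_bd L"


section \<open>The lattice gas\<close>

type_synonym config = "site \<Rightarrow> nat"

definition configs :: "nat \<Rightarrow> config set" where
  "configs L = Box L \<rightarrow>\<^sub>E {0, 1}"

text \<open>Unordered nearest-neighbor pairs are two-element sets \<open>{x, y}\<close>.\<close>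

definition pairs :: "nat \<Rightarrow> site set set" where
  "pairs L = {{x, y} | x y. x \<in> Box_int L \<and> y \<in> Box_int L \<and> nn x y}"

definition hamiltonian :: "nat \<Rightarrow> real \<Rightarrow> real \<Rightarrow> config \<Rightarrow> real" where
  "hamiltonian L U \<Delta> \<eta> =
     - U * (\<Sum>e\<in>pairs L. \<Prod>x\<in>e. real (\<eta> x)) + \<Delta> * (\<Sum>x\<in>Box L. real (\<eta> x))"

definition config_empty :: "nat \<Rightarrow> config" where
  "config_empty L = (\<lambda>x\<in>Box L. 0)"

definition config_full :: "nat \<Rightarrow> config" where
  "config_full L = (\<lambda>x\<in>Box L. if x \<in> Box_int L then 1 else 0)"


section \<open>Kawasaki dynamics\<close>

definition oriented_bonds :: "nat \<Rightarrow> (site \<times> site) set" where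
  "oriented_bonds L =
     {(x, y). nn x y \<and>
        (x \<in> Box L \<and> y \<in> Box L \<or> x \<in> Box_bd L \<and> y \<notin> Box L \<or> x \<notin> Box L \<and> y \<in> Box_bd L)}"

text \<open>The last branch of \<open>bond_move\<close> applies to bonds entering \<open>Box L\<close> (creation of a particle).\<close>

definition bond_move :: "nat \<Rightarrow> site \<times> site \<Rightarrow> config \<Rightarrow> config" where
  "bond_move L b \<eta> =
     (case b of (x, y) \<Rightarrow>
        if x \<in> Box L \<and> y \<in> Box L then \<eta>(x := \<eta> y, y := \<eta> x)
        else if x \<in> Box L then \<eta>(x := 0)
        else \<eta>(y := 1))"

definition kawasaki_off_diag ::
    "nat \<Rightarrow> real \<Rightarrow> real \<Rightarrow> real \<Rightarrow> config \<Rightarrow> config \<Rightarrow> real" where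
  "kawasaki_off_diag L U \<Delta> \<beta> \<eta> \<eta>' =
     (if \<exists>b\<in>oriented_bonds L. \<eta>' = bond_move L b \<eta>
      then 1 / real (card (oriented_bonds L))
             * exp (- \<beta> * max 0 (hamiltonian L U \<Delta> \<eta>' - hamiltonian L U \<Delta> \<eta>))
      else 0)"

definition kawasaki :: "nat \<Rightarrow> real \<Rightarrow> real \<Rightarrow> real \<Rightarrow> config \<Rightarrow> config \<Rightarrow> real" where
  "kawasaki L U \<Delta> \<beta> \<eta> \<eta>' =
     (if \<eta> = \<eta>' then 1 - (\<Sum>\<zeta>\<in>configs L - {\<eta>}. kawasaki_off_diag L U \<Delta> \<beta> \<eta> \<zeta>)
      else kawasaki_off_diag L U \<Delta> \<beta> \<eta> \<eta>')"


section \<open>The critical radius and the energy barrier\<close>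

definition crit_ratio :: "real \<Rightarrow> real \<Rightarrow> real" where
  "crit_ratio U \<Delta> = U / (2 * (3 * U - 2 * \<Delta>)) - 1 / 2"

definition crit_radius :: "real \<Rightarrow> real \<Rightarrow> int" where
  "crit_radius U \<Delta> = \<lfloor>crit_ratio U \<Delta>\<rfloor>"

definition crit_frac :: "real \<Rightarrow> real \<Rightarrow> real" where
  "crit_frac U \<Delta> = frac (crit_ratio U \<Delta>)"

definition Gamma1 :: "real \<Rightarrow> real \<Rightarrow> real" where
  "Gamma1 U \<Delta> = (let r = real_of_int (crit_radius U \<Delta>) in
     - 3 * (3 * r^2 - r) * U + 6 * r^2 * \<Delta> + 5 * (2 * r + 1) * \<Delta> - (15 * r + 4) * U + \<Delta>)"

definition Gamma2 :: "real \<Rightarrow> real \<Rightarrow> real" where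
  "Gamma2 U \<Delta> = (let r = real_of_int (crit_radius U \<Delta>) in
     - 3 * (3 * (r + 1)^2 - (r + 1)) * U + 6 * (r + 1)^2 * \<Delta>
     + (2 * r + 3) * \<Delta> - 3 * (r + 1) * U + \<Delta>)"

definition Gamma_KHex :: "real \<Rightarrow> real \<Rightarrow> real" where
  "Gamma_KHex U \<Delta> = (if crit_frac U \<Delta> < 1 / 2 then Gamma1 U \<Delta> else Gamma2 U \<Delta>)"

end

theory Submission
  imports Defs
begin

text \<open>
  Put \<open>\<epsilon> = 3 U - 2 \<Delta>\<close>. A set \<open>A\<close> of occupied sites of the hexagon has energy
  \<open>U / 2 * per A - \<epsilon> / 2 * card A\<close>, where the perimeter satisfies \<open>6 * card A \<le> (per A)\<^sup>2\<close> and has the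
  parity of \<open>card A\<close>. The number of particles grows only by creations outside the hexagon, each of
  which costs \<open>\<Delta>\<close>; hence a nucleation path is at least \<open>\<Delta>\<close> higher than the least energy at the
  critical number of particles, which gives the lower bound on the barrier.

  For the upper bound, hexagons of increasing radius are filled bar by bar. All clusters on the
  way have nearly minimal perimeter, and a new particle reaches its place along the strip of the bar.
  The centers of the hexagons may move, so such a growth can start around any site and end
  with the whole box. If \<open>S\<close> is neither empty nor full, start it around a particle of \<open>S\<close> and take the
  union with \<open>S\<close>. By submodularity the excess of the energy over that of \<open>S\<close> is the energy of the
  growing cluster \<open>A\<close> minus that of \<open>S \<inter> A\<close>, which saves at least \<open>\<Delta>\<close>; moving a particle through
  the obstacles in \<open>S\<close> costs at most \<open>\<Delta> + U < 2 \<Delta>\<close>. So the barrier is strictly lower than the one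
  from the empty configuration.
\<close>

subsection \<open>Strip coordinates\<close>

text \<open>The barrier is claimed exactly, so the upper and the lower bound must meet at one
  cluster. While a bar is filled, the bound on the energy peaks at two attached faces, where the
  perimeter is up by two; the next particle in transit adds \<Delta>. Maximizing over radii and bars
  selects the sixth bar on the hexagon of radius \<rho> if \<delta> < 1/2 and the second bar on
  radius \<rho> + 1 if \<delta> > 1/2: this is the origin of \<open>Gamma1\<close> and
  \<open>Gamma2\<close>. At that number of particles the isoperimetric inequality is off by one unit
  of perimeter, and parity removes this unit. Counting particles suffices for the lower bound
  because configurations with at most the critical number of them have nonnegative energy. The size
  of the box enters through U / \<epsilon> < L, which makes the energy of the full hexagon negative.
  The assumption \<epsilon> \<le> U / 100 makes \<Gamma> large compared with the few multiples of U
  and \<Delta> lost in crude estimates.\<close>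

text \<open>
  Each face lies in one strip of each of the three directions; \<open>ca\<close>, \<open>cb\<close>, \<open>cc\<close> number these
  strips, and crossing an edge changes exactly one of the three numbers, by one.
\<close>

fun ca :: "site \<Rightarrow> int" where "ca (Up a b) = a" | "ca (Down a b) = a"
fun cb :: "site \<Rightarrow> int" where "cb (Up a b) = b" | "cb (Down a b) = b"
fun cc :: "site \<Rightarrow> int" where "cc (Up a b) = a + b" | "cc (Down a b) = a + b + 1"

fun nbrs :: "site \<Rightarrow> site set" where
  "nbrs (Up a b) = {Down a b, Down (a - 1) b, Down a (b - 1)}"
| "nbrs (Down a b) = {Up a b, Up (a + 1) b, Up a (b + 1)}"

fun is_Up :: "site \<Rightarrow> bool" where "is_Up (Up a b) = True" | "is_Up (Down a b) = False"

lemma nn_common_corners: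
  assumes "nn x y"
  obtains p p' q q' where "(p, p') \<in> corners x" "(p, p') \<in> corners y"
    "(q, q') \<in> corners x" "(q, q') \<in> corners y" "p \<noteq> q \<or> p' \<noteq> q'"
proof -
  obtain p q where "corners x \<inter> corners y = {p, q}" "p \<noteq> q"
    using assms unfolding nn_def card_2_iff by blast
  then show thesis by (cases p; cases q; intro that) auto
qed

lemma card_corners [simp]: "card (corners x) = 3"
  by (cases x) auto

lemma nn_not_refl [simp]: "\<not> nn x x"
  by (simp add: nn_def)

lemma nn_sym: "nn x y \<longleftrightarrow> nn y x"
  by (simp add: nn_def Int_commute)

lemma nn_Up_Up [simp]: "\<not> nn (Up a b) (Up c d)"
proof
  assume *: "nn (Up a b) (Up c d)"
  obtain p p' q q' where "(p, p') \<in> corners (Up a b)" "(p, p') \<in> corners (Up c d)"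
    "(q, q') \<in> corners (Up a b)" "(q, q') \<in> corners (Up c d)" "p \<noteq> q \<or> p' \<noteq> q'"
    using * by (rule nn_common_corners)
  then have "a = c \<and> b = d"
    unfolding corners.simps insert_iff empty_iff prod.inject simp_thms by presburger
  then show False using * nn_not_refl by blast
qed

lemma nn_Down_Down [simp]: "\<not> nn (Down a b) (Down c d)"
proof
  assume *: "nn (Down a b) (Down c d)"
  obtain p p' q q' where "(p, p') \<in> corners (Down a b)" "(p, p') \<in> corners (Down c d)"
    "(q, q') \<in> corners (Down a b)" "(q, q') \<in> corners (Down c d)" "p \<noteq> q \<or> p' \<noteq> q'"
    using * by (rule nn_common_corners)
  then have "a = c \<and> b = d"
    unfolding corners.simps insert_iff empty_iff prod.inject simp_thms by presburger
  then show False using * nn_not_refl by blast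
qed

lemma nn_Up_Down: "nn (Up a b) (Down c d) \<longleftrightarrow> Down c d \<in> nbrs (Up a b)"
proof
  assume *: "nn (Up a b) (Down c d)"
  obtain p p' q q' where "(p, p') \<in> corners (Up a b)" "(p, p') \<in> corners (Down c d)"
    "(q, q') \<in> corners (Up a b)" "(q, q') \<in> corners (Down c d)" "p \<noteq> q \<or> p' \<noteq> q'"
    using * by (rule nn_common_corners)
  then have "(c = a \<and> d = b) \<or> (c = a - 1 \<and> d = b) \<or> (c = a \<and> d = b - 1)"
    unfolding corners.simps insert_iff empty_iff prod.inject simp_thms by presburger
  then show "Down c d \<in> nbrs (Up a b)" by auto
next
  have 1: "corners (Up a b) \<inter> corners (Down a b) = {(a + 1, b), (a, b + 1)}" by auto
  have 2: "corners (Up a b) \<inter> corners (Down (a - 1) b) = {(a, b), (a, b + 1)}" by auto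
  have 3: "corners (Up a b) \<inter> corners (Down a (b - 1)) = {(a, b), (a + 1, b)}" by auto
  assume "Down c d \<in> nbrs (Up a b)"
  then show "nn (Up a b) (Down c d)"
    unfolding nn_def using 1 2 3 by (auto simp del: corners.simps)
qed

lemma nn_iff: "nn x y \<longleftrightarrow> y \<in> nbrs x"
proof (cases x)
  case (Up a b)
  then show ?thesis by (cases y) (auto simp: nn_Up_Down simp del: nbrs.simps, auto)
next
  case (Down a b)
  show ?thesis
  proof (cases y)
    case (Up c d)
    then show ?thesis using Down nn_sym[of x y] by (auto simp: nn_Up_Down)
  next
    case (Down c d)
    then show ?thesis using \<open>x = Down a b\<close> by auto
  qed
qed

lemma nbrs_sym: "y \<in> nbrs x \<longleftrightarrow> x \<in> nbrs y"
  using nn_iff nn_sym by blast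

lemma card_nbrs [simp]: "card (nbrs x) = 3"
  by (cases x) auto

lemma finite_nbrs [simp]: "finite (nbrs x)"
  by (cases x) auto

lemma self_notin_nbrs [simp]: "x \<notin> nbrs x"
  by (cases x) auto

lemma is_Up_nbrs: "y \<in> nbrs x \<Longrightarrow> is_Up y \<longleftrightarrow> \<not> is_Up x"
  by (cases x) auto

lemma site_eqI: "ca x = ca y \<Longrightarrow> cb x = cb y \<Longrightarrow> cc x = cc y \<Longrightarrow> x = y"
  by (cases x; cases y) auto

lemma cc_cases: "cc x = ca x + cb x \<or> cc x = ca x + cb x + 1"
  by (cases x) auto

subsection \<open>Bonds and perimeter\<close>

text \<open>Every bond joins an \<open>Up\<close> face to a \<open>Down\<close> face, so listing the
  \<open>Up\<close> end first counts each unordered bond once.\<close>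

definition up_bonds :: "site set \<Rightarrow> (site \<times> site) set" where
  "up_bonds A = {(x, y). x \<in> A \<and> y \<in> A \<and> y \<in> nbrs x \<and> is_Up x}"

definition bonds :: "site set \<Rightarrow> nat" where
  "bonds A = card (up_bonds A)"

definition boundary :: "site set \<Rightarrow> (site \<times> site) set" where
  "boundary A = {(x, y). x \<in> A \<and> y \<notin> A \<and> y \<in> nbrs x}"

definition per :: "site set \<Rightarrow> nat" where
  "per A = card (boundary A)"

definition deg :: "site set \<Rightarrow> site \<Rightarrow> nat" where
  "deg A x = card (nbrs x \<inter> A)"

lemma boundary_Sigma: "boundary A = Sigma A (\<lambda>x. nbrs x - A)"
  by (auto simp: boundary_def)

lemma finite_up_bonds [simp]: "finite A \<Longrightarrow> finite (up_bonds A)"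
  by (rule finite_subset[of _ "A \<times> A"]) (auto simp: up_bonds_def)

lemma per_sum: "finite A \<Longrightarrow> per A = (\<Sum>x\<in>A. card (nbrs x - A))"
  by (simp add: per_def boundary_Sigma)

text \<open>Count the three sides of every face: a bond is seen from both ends, a boundary side from
  one. The identity trades bonds for perimeter in the energy and also yields the parity of the
  perimeter.\<close>

lemma bonds_per: assumes "finite A" shows "2 * bonds A + per A = 3 * card A"
proof -
  let ?D = "Sigma A (\<lambda>x. nbrs x \<inter> A)"
  have fin: "finite ?D" using assms by simp
  have "(x, y) \<in> ?D \<longleftrightarrow> (x, y) \<in> up_bonds A \<union> prod.swap ` up_bonds A" for x y
    using is_Up_nbrs[of y x] nbrs_sym[of x y] by (auto simp: up_bonds_def)
  then have "?D = up_bonds A \<union> prod.swap ` up_bonds A" by (intro set_eqI) (metis surj_pair)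
  moreover have "(x, y) \<notin> up_bonds A \<inter> prod.swap ` up_bonds A" for x y
    using is_Up_nbrs[of y x] by (auto simp: up_bonds_def)
  then have "up_bonds A \<inter> prod.swap ` up_bonds A = {}" by (metis equals0I surj_pair)
  moreover have "card (prod.swap ` up_bonds A) = card (up_bonds A)"
    by (rule card_image) simp
  ultimately have "card ?D = 2 * bonds A"
    using assms by (simp add: card_Un_disjoint bonds_def)
  moreover have "card ?D + per A = (\<Sum>x\<in>A. card (nbrs x \<inter> A) + card (nbrs x - A))"
    using assms by (simp add: per_sum sum.distrib)
  moreover have "card (nbrs x \<inter> A) + card (nbrs x - A) = 3" for x
    using card_Int_Diff[of "nbrs x" A] by simp
  ultimately show ?thesis by simp
qed

lemma even_per: "finite A \<Longrightarrow> even (per A) \<longleftrightarrow> even (card A)"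
  using bonds_per[of A] by presburger

lemma bonds_insert:
  assumes "finite A" "x \<notin> A"
  shows "bonds (insert x A) = bonds A + deg A x"
proof -
  let ?N = "if is_Up x then {x} \<times> (nbrs x \<inter> A) else (nbrs x \<inter> A) \<times> {x}"
  have "(y, z) \<in> up_bonds (insert x A) \<longleftrightarrow> (y, z) \<in> up_bonds A \<union> ?N" for y z
    using is_Up_nbrs[of z y] nbrs_sym[of z y] assms by (auto simp: up_bonds_def)
  then have "up_bonds (insert x A) = up_bonds A \<union> ?N" by (intro set_eqI) (metis surj_pair)
  moreover have "up_bonds A \<inter> ?N = {}"
    unfolding up_bonds_def using assms by auto
  moreover have "card ?N = deg A x" by (simp add: deg_def card_cartesian_product)
  ultimately show ?thesis
    using assms by (simp add: bonds_def card_Un_disjoint)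
qed

lemma per_insert:
  assumes "finite A" "x \<notin> A"
  shows "per (insert x A) + 2 * deg A x = per A + 3"
  using bonds_per[of "insert x A"] bonds_per[of A] bonds_insert[OF assms] assms by simp

text \<open>Bonds between \<open>A - B\<close> and \<open>B - A\<close> appear only in the union.
  This is the source of the submodularity of the energy.\<close>

lemma bonds_supermodular:
  assumes "finite A" "finite B"
  shows "bonds A + bonds B \<le> bonds (A \<union> B) + bonds (A \<inter> B)"
proof -
  have "bonds A + bonds B = card (up_bonds A \<union> up_bonds B) + card (up_bonds A \<inter> up_bonds B)"
    unfolding bonds_def using assms by (intro card_Un_Int finite_up_bonds)
  moreover have "up_bonds A \<inter> up_bonds B = up_bonds (A \<inter> B)" by (auto simp: up_bonds_def)
  moreover have "card (up_bonds A \<union> up_bonds B) \<le> bonds (A \<union> B)"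
    unfolding bonds_def using assms
    by (intro card_mono finite_up_bonds finite_UnI) (auto simp: up_bonds_def)
  ultimately show ?thesis by (simp add: bonds_def)
qed

subsection \<open>The isoperimetric inequality\<close>

lemma exists_lower_part:
  fixes X :: "'a::linorder set"
  assumes "finite X" "t \<le> card X"
  shows "\<exists>X1\<subseteq>X. card X1 = t \<and> (\<forall>x\<in>X1. \<forall>y\<in>X - X1. x < y)"
  using assms(2)
proof (induction t)
  case (Suc t)
  then obtain X1 where X1: "X1 \<subseteq> X" "card X1 = t" "\<forall>x\<in>X1. \<forall>y\<in>X - X1. x < y" by auto
  have fin: "finite (X - X1)" using assms(1) by simp
  have "X - X1 \<noteq> {}"
    using X1 Suc.prems assms(1) by (metis Diff_eq_empty_iff card_mono finite_subset not_less_eq_eq)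
  then have m: "Min (X - X1) \<in> X - X1" "\<And>y. y \<in> X - X1 \<Longrightarrow> Min (X - X1) \<le> y"
    using fin Min_in[of "X - X1"] by (blast, simp)
  have "card (insert (Min (X - X1)) X1) = Suc t"
    using m(1) X1 assms(1) finite_subset by (subst card_insert_disjoint) auto
  moreover have "\<forall>x\<in>insert (Min (X - X1)) X1. \<forall>y\<in>X - insert (Min (X - X1)) X1. x < y"
    using X1 m by (auto simp: order.strict_iff_order)
  ultimately show ?case using X1 m(1) by (intro exI[of _ "insert (Min (X - X1)) X1"]) auto
qed auto

lemma exists_upper_part:
  fixes X :: "int set"
  assumes "finite X" "t \<le> card X"
  shows "\<exists>X1\<subseteq>X. card X1 = t \<and> (\<forall>x\<in>X1. \<forall>y\<in>X - X1. y < x)"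
proof -
  have "\<exists>X1\<subseteq>X. card X1 = card X - t \<and> (\<forall>x\<in>X1. \<forall>y\<in>X - X1. x < y)"
    using assms by (intro exists_lower_part) auto
  then obtain X1 where X1: "X1 \<subseteq> X" "card X1 = card X - t" "\<forall>x\<in>X1. \<forall>y\<in>X - X1. x < y" by auto
  have "X - (X - X1) = X1" using X1 by auto
  moreover have "card (X - X1) = t"
    using X1 assms by (metis card_Diff_subset diff_diff_cancel finite_subset)
  ultimately show ?thesis using X1 by (intro exI[of _ "X - X1"]) auto
qed

text \<open>
  Among the representations \<open>z = x + y\<close> meeting the \<open>t\<close> smallest elements of \<open>X\<close> or the \<open>t\<close>
  largest elements of \<open>Y\<close>, either all do the former or all do the latter, so there are at most
  \<open>t\<close> of them for each \<open>z\<close>.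
\<close>

lemma sums_in_set_bound:
  fixes X Y Z :: "int set"
  assumes fin: "finite X" "finite Y" "finite Z" and t: "t \<le> card X" "t \<le> card Y"
  shows "card {(x, y). x \<in> X \<and> y \<in> Y \<and> x + y \<in> Z} \<le> t * card Z + (card X - t) * (card Y - t)"
proof -
  obtain X1 where X1: "X1 \<subseteq> X" "card X1 = t" "\<forall>x\<in>X1. \<forall>y\<in>X - X1. x < y"
    using exists_lower_part[OF fin(1) t(1)] by auto
  obtain Y1 where Y1: "Y1 \<subseteq> Y" "card Y1 = t" "\<forall>x\<in>Y1. \<forall>y\<in>Y - Y1. y < x"
    using exists_upper_part[OF fin(2) t(2)] by auto
  have f1: "finite X1" "finite Y1" using X1 Y1 fin finite_subset by auto
  define G where "G z = {(x, y). x \<in> X \<and> y \<in> Y \<and> x + y = z \<and> (x \<in> X1 \<or> y \<in> Y1)}" for z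
  have G: "card (G z) \<le> t" for z
  proof (cases "\<exists>x y. (x, y) \<in> G z \<and> x \<notin> X1")
    case True
    then obtain x y where xy: "x \<in> X" "x \<notin> X1" "y \<in> Y1" "x + y = z" by (auto simp: G_def)
    have "y' \<in> Y1" if g: "(x', y') \<in> G z" for x' y'
    proof (rule ccontr)
      assume "y' \<notin> Y1"
      then have "x' \<in> X1" "y' \<in> Y - Y1" "x' + y' = z" using g by (auto simp: G_def)
      then have "x' < x" "y' < y" using xy X1 Y1 by auto
      then show False using xy \<open>x' + y' = z\<close> by simp
    qed
    then have "snd ` G z \<subseteq> Y1" by auto
    moreover have "inj_on snd (G z)" by (auto simp: inj_on_def G_def)
    ultimately show ?thesis using Y1 f1 by (metis card_image card_mono)
  next
    case False
    then have "fst ` G z \<subseteq> X1" by auto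
    moreover have "inj_on fst (G z)" by (auto simp: inj_on_def G_def)
    ultimately show ?thesis using X1 f1 by (metis card_image card_mono)
  qed
  have "{(x, y). x \<in> X \<and> y \<in> Y \<and> x + y \<in> Z} \<subseteq> (\<Union>z\<in>Z. G z) \<union> (X - X1) \<times> (Y - Y1)"
    by (auto simp: G_def)
  moreover have fG: "finite (G z)" for z
    by (rule finite_subset[of _ "X \<times> Y"]) (auto simp: G_def fin)
  ultimately have "card {(x, y). x \<in> X \<and> y \<in> Y \<and> x + y \<in> Z}
      \<le> card ((\<Union>z\<in>Z. G z) \<union> (X - X1) \<times> (Y - Y1))"
    using fin by (intro card_mono) auto
  also have "\<dots> \<le> card (\<Union>z\<in>Z. G z) + card ((X - X1) \<times> (Y - Y1))" by (rule card_Un_le)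
  also have "card (\<Union>z\<in>Z. G z) \<le> (\<Sum>z\<in>Z. card (G z))" using fin by (intro card_UN_le) auto
  also have "\<dots> \<le> (\<Sum>z\<in>Z. t)" by (intro sum_mono G)
  also have "card ((X - X1) \<times> (Y - Y1)) = (card X - t) * (card Y - t)"
    using X1 Y1 f1 by (simp add: card_cartesian_product card_Diff_subset)
  finally show ?thesis by (simp add: mult.commute)
qed

text \<open>Faces of one orientation are determined by \<open>ca\<close> and \<open>cb\<close>,
  whose sum is \<open>cc\<close> for \<open>Up\<close> and \<open>cc - 1\<close> for
  \<open>Down\<close>. Each orientation is thus a set of pairs with prescribed sums, whence the
  factor 2. The parameter \<open>t\<close> stays free, to be optimized later.\<close>

lemma card_le_strips:
  assumes A: "finite A" and t: "t \<le> card (ca ` A)" "t \<le> card (cb ` A)"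
  shows "card A \<le> 2 * (t * card (cc ` A) + (card (ca ` A) - t) * (card (cb ` A) - t))"
proof -
  define S where "S Z = {(x, y). x \<in> ca ` A \<and> y \<in> cb ` A \<and> x + y \<in> Z}" for Z
  define f where "f x = (ca x, cb x)" for x
  let ?U = "{x \<in> A. is_Up x}" and ?D = "{x \<in> A. \<not> is_Up x}"
  let ?Z' = "(\<lambda>z. z - 1) ` cc ` A"
  have fS: "finite (S Z)" for Z
    by (rule finite_subset[of _ "ca ` A \<times> cb ` A"]) (auto simp: S_def A)
  have inj: "inj_on f ?U" "inj_on f ?D"
    by (auto intro!: inj_onI simp: f_def elim!: is_Up.elims)
  have "f x \<in> S (cc ` A)" if "x \<in> ?U" for x
    using that by (cases x) (force simp: S_def f_def image_iff)+
  then have 1: "card ?U \<le> card (S (cc ` A))"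
    using card_inj_on_le[OF inj(1) _ fS] by blast
  have "f x \<in> S ?Z'" if "x \<in> ?D" for x
    using that by (cases x) (force simp: S_def f_def image_iff)+
  then have 2: "card ?D \<le> card (S ?Z')"
    using card_inj_on_le[OF inj(2) _ fS] by blast
  have "card ?Z' = card (cc ` A)" by (rule card_image) (simp add: inj_on_def)
  then have 3: "card (S ?Z') \<le> t * card (cc ` A) + (card (ca ` A) - t) * (card (cb ` A) - t)"
    using sums_in_set_bound[of "ca ` A" "cb ` A" ?Z' t] A t by (simp add: S_def)
  have 4: "card (S (cc ` A)) \<le> t * card (cc ` A) + (card (ca ` A) - t) * (card (cb ` A) - t)"
    using sums_in_set_bound[of "ca ` A" "cb ` A" "cc ` A" t] A t by (simp add: S_def)
  have "A = ?U \<union> ?D" by auto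
  moreover have "card (?U \<union> ?D) = card ?U + card ?D"
    using A by (intro card_Un_disjoint) auto
  ultimately have "card A = card ?U + card ?D" by simp
  then show ?thesis
    using add_mono[OF order_trans[OF 1 4] order_trans[OF 2 3]] unfolding mult_2 by (simp only:)
qed

section \<open>Perimeter and the number of strips met\<close>

fun a_fwd :: "site \<Rightarrow> site" where "a_fwd (Up a b) = Down a b" | "a_fwd (Down a b) = Up a (b + 1)"
fun a_bwd :: "site \<Rightarrow> site" where "a_bwd (Up a b) = Down a (b - 1)" | "a_bwd (Down a b) = Up a b"
fun b_fwd :: "site \<Rightarrow> site" where "b_fwd (Up a b) = Down a b" | "b_fwd (Down a b) = Up (a + 1) b"
fun b_bwd :: "site \<Rightarrow> site" where "b_bwd (Up a b) = Down (a - 1) b" | "b_bwd (Down a b) = Up a b"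
fun c_fwd :: "site \<Rightarrow> site" where "c_fwd (Up a b) = Down a (b - 1)" | "c_fwd (Down a b) = Up (a + 1) b"
fun c_bwd :: "site \<Rightarrow> site" where "c_bwd (Up a b) = Down (a - 1) b" | "c_bwd (Down a b) = Up a (b + 1)"

text \<open>Here \<open>s\<close> is a step along a strip and \<open>pos\<close> a position that
  increases with it: in each strip that meets \<open>A\<close>, the last face of \<open>A\<close> is
  left by \<open>s\<close>.\<close>

lemma card_strips_le_exits:
  fixes pos :: "site \<Rightarrow> int" and \<kappa> :: "site \<Rightarrow> int"
  assumes A: "finite A" and s: "\<And>x. \<kappa> (s x) = \<kappa> x" "\<And>x. pos x < pos (s x)"
  shows "card (\<kappa> ` A) \<le> (\<Sum>x\<in>A. of_bool (s x \<notin> A))"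
proof -
  let ?E = "{x \<in> A. s x \<notin> A}"
  have "\<kappa> ` A \<subseteq> \<kappa> ` ?E"
  proof
    fix k assume "k \<in> \<kappa> ` A"
    then have ne: "{x \<in> A. \<kappa> x = k} \<noteq> {}" and fin: "finite {x \<in> A. \<kappa> x = k}" using A by auto
    have "Max (pos ` {x \<in> A. \<kappa> x = k}) \<in> pos ` {x \<in> A. \<kappa> x = k}"
      using ne fin by (intro Max_in) auto
    then obtain x where x: "x \<in> A" "\<kappa> x = k" "pos x = Max (pos ` {x \<in> A. \<kappa> x = k})" by auto
    have "s x \<notin> A"
    proof
      assume "s x \<in> A"
      then have "pos (s x) \<le> pos x" using x s fin by auto
      then show False using s(2)[of x] by simp
    qed
    then show "k \<in> \<kappa> ` ?E" using x by auto
  qed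
  then have "card (\<kappa> ` A) \<le> card (\<kappa> ` ?E)" using A by (intro card_mono) auto
  also have "\<dots> \<le> card ?E" using A by (intro card_image_le) auto
  also have "card ?E = (\<Sum>x\<in>A. of_bool (s x \<notin> A))"
    using A by (simp add: sum.If_cases of_bool_def Int_def)
  finally show ?thesis .
qed

text \<open>Each strip is left by \<open>A\<close> in both directions, which gives twice the number
  of strips. Two faces with a common side lie in two common strips, so the six kinds of exits count
  every boundary side twice.\<close>

lemma strips_le_per:
  assumes A: "finite A"
  shows "card (ca ` A) + card (cb ` A) + card (cc ` A) \<le> per A"
proof -
  let ?e = "\<lambda>s. \<Sum>x\<in>A. of_bool (s x \<notin> A) :: nat"
  have "card (ca ` A) \<le> ?e a_fwd"
  proof (rule card_strips_le_exits[OF A, where pos = "\<lambda>x. cb x + cc x"])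
    show "ca (a_fwd x) = ca x" "cb x + cc x < cb (a_fwd x) + cc (a_fwd x)" for x by (cases x; simp)+
  qed
  moreover have "card (ca ` A) \<le> ?e a_bwd"
  proof (rule card_strips_le_exits[OF A, where pos = "\<lambda>x. - cb x - cc x"])
    show "ca (a_bwd x) = ca x" "- cb x - cc x < - cb (a_bwd x) - cc (a_bwd x)" for x by (cases x; simp)+
  qed
  moreover have "card (cb ` A) \<le> ?e b_fwd"
  proof (rule card_strips_le_exits[OF A, where pos = "\<lambda>x. ca x + cc x"])
    show "cb (b_fwd x) = cb x" "ca x + cc x < ca (b_fwd x) + cc (b_fwd x)" for x by (cases x; simp)+
  qed
  moreover have "card (cb ` A) \<le> ?e b_bwd"
  proof (rule card_strips_le_exits[OF A, where pos = "\<lambda>x. - ca x - cc x"])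
    show "cb (b_bwd x) = cb x" "- ca x - cc x < - ca (b_bwd x) - cc (b_bwd x)" for x by (cases x; simp)+
  qed
  moreover have "card (cc ` A) \<le> ?e c_fwd"
  proof (rule card_strips_le_exits[OF A, where pos = "\<lambda>x. ca x - cb x"])
    show "cc (c_fwd x) = cc x" "ca x - cb x < ca (c_fwd x) - cb (c_fwd x)" for x by (cases x; simp)+
  qed
  moreover have "card (cc ` A) \<le> ?e c_bwd"
  proof (rule card_strips_le_exits[OF A, where pos = "\<lambda>x. cb x - ca x"])
    show "cc (c_bwd x) = cc x" "cb x - ca x < cb (c_bwd x) - ca (c_bwd x)" for x by (cases x; simp)+
  qed
  moreover have "?e a_fwd + ?e a_bwd + ?e b_fwd + ?e b_bwd + ?e c_fwd + ?e c_bwd = 2 * per A"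
  proof -
    have *: "card (nbrs x - A) = (\<Sum>y\<in>nbrs x. of_bool (y \<notin> A))" for x
      by (simp add: sum.If_cases of_bool_def Diff_eq Compl_eq)
    have "of_bool (a_fwd x \<notin> A) + of_bool (a_bwd x \<notin> A) + of_bool (b_fwd x \<notin> A) + of_bool (b_bwd x \<notin> A)
        + of_bool (c_fwd x \<notin> A) + of_bool (c_bwd x \<notin> A) = 2 * card (nbrs x - A)" for x
      unfolding * by (cases x) simp_all
    then show ?thesis
      unfolding per_sum[OF A] sum_distrib_left sum.distrib[symmetric] by simp
  qed
  ultimately show ?thesis by linarith
qed

lemma e2_le_square:
  fixes x y z :: int
  shows "3 * (x * y + y * z + z * x) \<le> (x + y + z)^2"
proof -
  have "0 \<le> (x - y)^2 + (y - z)^2 + (z - x)^2" by simp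
  then show ?thesis by (simp add: power2_eq_square algebra_simps)
qed

text \<open>With \<open>u\<close>, \<open>v\<close>, \<open>w\<close> the numbers of strips met, the
  bound is optimized over \<open>t\<close>. The parity enters when \<open>u = v = w\<close> is odd,
  where the optimized bound alone exceeds the goal.\<close>

lemma isoperimetric_arith:
  fixes u v w n p :: int
  assumes bound: "\<And>t. 0 \<le> t \<Longrightarrow> t \<le> u \<Longrightarrow> t \<le> v \<Longrightarrow> n \<le> 2 * (t * w + (u - t) * (v - t))"
    and nonneg: "0 \<le> u" "0 \<le> v" "0 \<le> w" and p: "u + v + w \<le> p" and par: "even p \<longleftrightarrow> even n"
  shows "6 * n \<le> p^2"
proof -
  have sq: "q^2 \<le> p^2" if "0 \<le> q" "q \<le> p" for q using that by (intro power_mono)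
  have prod: "12 * (x * y) \<le> p^2" if "0 \<le> x" "0 \<le> y" "2 * (x + y) \<le> p" for x y
  proof -
    have "(2 * (x + y))^2 - 12 * (x * y) = 4 * (x - y)^2 + 4 * (x * y)"
      by (simp add: power2_eq_square algebra_simps)
    then have "12 * (x * y) \<le> (2 * (x + y))^2"
      using zero_le_power2[of "x - y"] mult_nonneg_nonneg[OF that(1,2)] by linarith
    also have "\<dots> \<le> p^2" using that by (intro sq) auto
    finally show ?thesis .
  qed
  consider "w \<ge> u + v" | "v \<ge> u + w" | "u \<ge> v + w" | "w < u + v" "v < u + w" "u < v + w" by linarith
  then show ?thesis
  proof cases
    case 1
    then show ?thesis using bound[of 0] prod[of u v] nonneg p by simp
  next
    case 2
    then show ?thesis using bound[of u] prod[of u w] nonneg p by simp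
  next
    case 3
    then show ?thesis using bound[of v] prod[of v w] nonneg p by simp
  next
    case 4
    \<comment> \<open>The bound is quadratic in \<open>t\<close> with its minimum at half of
      \<open>u + v - w\<close>; rounding is what makes the odd case delicate.\<close>
    define t where "t = (u + v - w) div 2"
    have t: "0 \<le> t" "t \<le> u" "t \<le> v" using 4 by (auto simp: t_def)
    define x y where "x = u - t" and "y = v - t"
    note b = bound[OF t]
    show ?thesis
    proof (cases "even (u + v - w)")
      case True
      then have w: "w = x + y" by (auto simp: t_def x_def y_def)
      have "6 * n \<le> 12 * (x * y + y * t + t * x)"
        using b unfolding w by (simp add: x_def y_def algebra_simps)
      also have "\<dots> \<le> (2 * (x + y + t))^2" 
        using e2_le_square[of x y t] unfolding power_mult_distrib by simp
      also have "2 * (x + y + t) = u + v + w" unfolding w by (simp add: x_def y_def)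
      also have "(u + v + w)^2 \<le> p^2" using nonneg p by (intro sq) auto
      finally show ?thesis .
    next
      case False
      then have w: "w = x + y - 1" unfolding t_def x_def y_def by presburger
      \<comment> \<open>Deviations from the balanced case \<open>u = v = w = 2 * t + 1\<close>. The
        form \<open>d\<close> is positive definite, so any deviation gives \<open>d \<ge> 1\<close>,
        and \<open>4 * d\<close> absorbs the surplus 3 in \<open>eq\<close>.\<close>
      define k l where "k = x - t - 1" and "l = y - t - 1"
      have u: "u = 2 * t + 1 + k" and v: "v = 2 * t + 1 + l" and w': "w = 2 * t + 1 + k + l"
        using w by (auto simp: k_def l_def x_def y_def)
      define q where "q = u + v + w"
      have q: "0 \<le> q" "q \<le> p" using nonneg p by (auto simp: q_def)
      define m d where "m = t * w + (u - t) * (v - t)" and "d = k^2 + l^2 - k * l"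
      have b': "n \<le> 2 * m" using b unfolding m_def .
      have eq: "12 * m + 4 * d = q^2 + 3"
        unfolding m_def d_def q_def u v w' by (simp add: power2_eq_square algebra_simps)
      show ?thesis
      proof (cases "k = 0 \<and> l = 0")
        case False
        then have "d > 0"
        proof -
          have "2 * d = k^2 + l^2 + (k - l)^2" unfolding d_def by (simp add: power2_eq_square algebra_simps)
          moreover have "k^2 + l^2 > 0" using False by (simp add: sum_power2_gt_zero_iff)
          ultimately show ?thesis using zero_le_power2[of "k - l"] by linarith
        qed
        then have "6 * n \<le> q^2" using b' eq by linarith
        then show ?thesis using sq[OF q] by linarith
      next
        case True
        then have eq': "12 * m = q^2 + 3" using eq by (simp add: d_def)
        have qodd: "q = 6 * t + 3" using True by (simp add: q_def u v w')
        \<comment> \<open>The surplus 3 remains here. If \<open>q = p\<close>, then \<open>n\<close>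
          is odd and misses the even bound \<open>2 * m\<close> by at least one, which gains 6;
          otherwise \<open>p\<close> exceeds \<open>q\<close> and the square grows by
          enough.\<close>
        show ?thesis
        proof (cases "q = p")
          case True
          then have "odd n" using par qodd by presburger
          then have "n \<noteq> 2 * m" by auto
          then have "6 * n \<le> q^2" using b' eq' by linarith
          then show ?thesis using True by simp
        next
          case False
          then have "(q + 1)^2 \<le> p^2" using q by (intro sq) auto
          moreover have "q^2 + 3 \<le> (q + 1)^2" using qodd t by (simp add: power2_eq_square algebra_simps)
          ultimately show ?thesis using b' eq' by linarith
        qed
      qed
    qed
  qed
qed

lemma isoperimetric:
  assumes A: "finite A"
  shows "6 * int (card A) \<le> int (per A)^2"
proof (rule isoperimetric_arith[where u = "int (card (ca ` A))" and v = "int (card (cb ` A))"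
      and w = "int (card (cc ` A))"])
  fix t assume t: "0 \<le> t" "t \<le> int (card (ca ` A))" "t \<le> int (card (cb ` A))"
  then have "card A \<le> 2 * (nat t * card (cc ` A) + (card (ca ` A) - nat t) * (card (cb ` A) - nat t))"
    using A by (intro card_le_strips) auto
  then have "int (card A) \<le> int (2 * (nat t * card (cc ` A) + (card (ca ` A) - nat t) * (card (cb ` A) - nat t)))"
    by (simp only: of_nat_le_iff)
  also have "\<dots> = 2 * (t * int (card (cc ` A)) + (int (card (ca ` A)) - t) * (int (card (cb ` A)) - t))"
    using t by (simp add: of_nat_diff nat_le_iff)
  finally show "int (card A) \<le> 2 * (t * int (card (cc ` A)) + (int (card (ca ` A)) - t) * (int (card (cb ` A)) - t))" .
qed (use strips_le_per[OF A] even_per[OF A] in auto)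

subsection \<open>Hexagonal regions\<close>

text \<open>Strip \<open>k\<close> lies between the lattice lines \<open>k\<close> and
  \<open>k + 1\<close>; with half-open ranges the six bounds are the lines that carry the
  sides.\<close>

definition region :: "int \<Rightarrow> int \<Rightarrow> int \<Rightarrow> int \<Rightarrow> int \<Rightarrow> int \<Rightarrow> site set" where
  "region a1 a2 b1 b2 c1 c2 =
     {x. a1 \<le> ca x \<and> ca x < a2 \<and> b1 \<le> cb x \<and> cb x < b2 \<and> c1 \<le> cc x \<and> cc x < c2}"

definition Hex :: "nat \<Rightarrow> int \<Rightarrow> int \<Rightarrow> site set" where
  "Hex R p q = region (p - int R) (p + int R) (q - int R) (q + int R) (p + q - int R) (p + q + int R)"

lemma hexagon_eq_Hex: "hexagon L = Hex L 0 0"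
proof -
  have "x \<in> hexagon L \<longleftrightarrow> x \<in> Hex L 0 0" for x
    by (cases x; simp add: hexagon_def Hex_def region_def abs_le_iff; linarith)
  then show ?thesis by auto
qed

lemma finite_region [simp]: "finite (region a1 a2 b1 b2 c1 c2)"
proof (rule finite_subset)
  show "region a1 a2 b1 b2 c1 c2 \<subseteq> case_prod Up ` ({a1..a2} \<times> {b1..b2}) \<union> case_prod Down ` ({a1..a2} \<times> {b1..b2})"
  proof
    fix x assume "x \<in> region a1 a2 b1 b2 c1 c2"
    then show "x \<in> case_prod Up ` ({a1..a2} \<times> {b1..b2}) \<union> case_prod Down ` ({a1..a2} \<times> {b1..b2})"
      by (cases x) (auto simp: region_def image_iff)
  qed
qed auto

lemma finite_Hex [simp]: "finite (Hex R p q)"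
  by (simp add: Hex_def)

lemma finite_hexagon [simp]: "finite (hexagon L)"
  by (simp add: hexagon_eq_Hex)

text \<open>Rotation by \<open>\<pi>/3\<close> about the vertex \<open>(0, 0)\<close>, which maps \<open>(a, b)\<close> to \<open>(- b, a + b)\<close>.\<close>

fun rot :: "site \<Rightarrow> site" where
  "rot (Up a b) = Down (- b - 1) (a + b)"
| "rot (Down a b) = Up (- b - 1) (a + b + 1)"

lemma rot_coords [simp]: "ca (rot x) = - cb x - 1" "cb (rot x) = cc x" "cc (rot x) = ca x"
  by (cases x; simp)+

lemma inj_rot: "inj rot"
proof (rule injI)
  fix x y assume "rot x = rot y"
  then have "ca (rot x) = ca (rot y)" "cb (rot x) = cb (rot y)" "cc (rot x) = cc (rot y)" by simp_all
  then show "x = y" by (intro site_eqI) simp_all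
qed

lemma surj_rot: "surj rot"
  unfolding surj_def
proof
  fix y
  show "\<exists>x. y = rot x"
  proof (cases y)
    case (Up a b)
    then show ?thesis by (intro exI[of _ "Down (a + b) (- a - 1)"]) simp
  next
    case (Down a b)
    then show ?thesis by (intro exI[of _ "Up (a + b + 1) (- a - 1)"]) simp
  qed
qed

lemma nbrs_rot: "nbrs (rot x) = rot ` nbrs x"
  by (cases x) auto

lemma rot_region: "rot ` region a1 a2 b1 b2 c1 c2 = region (- b2) (- b1) c1 c2 a1 a2"
proof -
  have "rot x \<in> rot ` region a1 a2 b1 b2 c1 c2 \<longleftrightarrow> rot x \<in> region (- b2) (- b1) c1 c2 a1 a2" for x
    by (auto simp: inj_image_mem_iff[OF inj_rot] region_def)
  then show ?thesis using surj_rot by (metis (no_types, lifting) rangeE set_eqI UNIV_I)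
qed

lemma rot_Hex: "rot ` Hex R p q = Hex R (- q) (p + q)"
  by (simp add: Hex_def rot_region algebra_simps)

subsection \<open>Bars\<close>

text \<open>
  A bar is an initial segment of a walk along a strip that runs alongside \<open>K\<close>; every other face
  of the bar has a side in common with \<open>K\<close>. The walk \<open>f\<close> is infinite since its continuation
  beyond the bar is the escape route of the particles that are attached.
\<close>

definition walk :: "(nat \<Rightarrow> site) \<Rightarrow> bool" where
  "walk f \<longleftrightarrow> inj f \<and> (\<forall>j. f (Suc j) \<in> nbrs (f j))"

definition alongside :: "site set \<Rightarrow> nat \<Rightarrow> (nat \<Rightarrow> site) \<Rightarrow> bool" where
  "alongside K m f \<longleftrightarrow> walk f \<and> range f \<inter> K = {} \<and> (\<forall>j<m. even j \<longrightarrow> nbrs (f j) \<inter> K \<noteq> {})"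

definition bar :: "site set \<Rightarrow> nat \<Rightarrow> site set \<Rightarrow> bool" where
  "bar K m K' \<longleftrightarrow> (\<exists>f. alongside K m f \<and> K' = K \<union> f ` {..<m})"

lemma bar_rot:
  assumes "bar K m K'"
  shows "bar (rot ` K) m (rot ` K')"
proof -
  obtain f where f: "alongside K m f" "K' = K \<union> f ` {..<m}" using assms by (auto simp: bar_def)
  have "walk (rot \<circ> f)"
    using f(1) inj_compose[OF inj_rot] by (auto simp: alongside_def walk_def nbrs_rot)
  moreover have "range (rot \<circ> f) \<inter> rot ` K = {}"
    using f(1) inj_rot by (auto simp: alongside_def dest: injD)
  moreover have "nbrs ((rot \<circ> f) j) \<inter> rot ` K \<noteq> {}" if "j < m" "even j" for j
    using f(1) that by (auto simp: alongside_def nbrs_rot)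
  ultimately show ?thesis
    unfolding bar_def alongside_def using f(2) by (intro exI[of _ "rot \<circ> f"]) (auto simp: image_Un image_comp)
qed

text \<open>The inequalities make the constraints from \<open>a2\<close> and \<open>c1\<close>
  inactive on the new row, which therefore runs from \<open>Up a1 b2\<close> to
  \<open>Up (c2 - b2 - 1) b2\<close>. The other five sides are obtained from this one by successive
  rotations.\<close>

lemma bar_b2:
  assumes "b1 < b2" "c2 - b2 \<le> a2" "c1 \<le> a1 + b2" and m: "int m = 2 * (c2 - b2 - a1) - 1"
  shows "bar (region a1 a2 b1 b2 c1 c2) m (region a1 a2 b1 (b2 + 1) c1 c2)"
proof -
  define f where "f j = (if even j then Up (a1 + int (j div 2)) b2 else Down (a1 + int (j div 2)) b2)" for j :: nat
  have cb_f: "cb (f j) = b2" for j by (simp add: f_def)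
  have "walk f"
    unfolding walk_def
  proof
    show "inj f"
    proof (rule injI)
      fix i j assume "f i = f j"
      then have "even i \<longleftrightarrow> even j" "i div 2 = j div 2" by (auto simp: f_def split: if_splits)
      then show "i = j" by presburger
    qed
    show "\<forall>j. f (Suc j) \<in> nbrs (f j)" by (auto simp: f_def)
  qed
  moreover have "range f \<inter> region a1 a2 b1 b2 c1 c2 = {}"
    using cb_f by (auto simp: region_def)
  moreover have "Down (a1 + int (j div 2)) (b2 - 1) \<in> nbrs (f j) \<inter> region a1 a2 b1 b2 c1 c2"
    if "j < m" "even j" for j
  proof -
    have "int (j div 2) < c2 - b2 - a1" using that m by presburger
    then show ?thesis using assms that by (auto simp: f_def region_def)
  qed
  then have "\<forall>j<m. even j \<longrightarrow> nbrs (f j) \<inter> region a1 a2 b1 b2 c1 c2 \<noteq> {}" by blast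
  moreover have "region a1 a2 b1 (b2 + 1) c1 c2 = region a1 a2 b1 b2 c1 c2 \<union> f ` {..<m}"
  proof (intro subset_antisym subsetI)
    fix x assume x: "x \<in> region a1 a2 b1 (b2 + 1) c1 c2"
    show "x \<in> region a1 a2 b1 b2 c1 c2 \<union> f ` {..<m}"
    proof (cases "cb x = b2")
      case True
      show ?thesis
      proof (cases x)
        case (Up a b)
        then have "x = f (2 * nat (a - a1))" "2 * nat (a - a1) < m"
          using x True m by (auto simp: f_def region_def)
        then show ?thesis by auto
      next
        case (Down a b)
        then have "x = f (2 * nat (a - a1) + 1)" "2 * nat (a - a1) + 1 < m"
          using x True m by (auto simp: f_def region_def)
        then show ?thesis by auto
      qed
    qed (use x in \<open>auto simp: region_def\<close>)
  next
    fix x assume x: "x \<in> region a1 a2 b1 b2 c1 c2 \<union> f ` {..<m}"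
    moreover have "f j \<in> region a1 a2 b1 (b2 + 1) c1 c2" if "j < m" for j
    proof (cases "even j")
      case True
      then have "int (j div 2) < c2 - b2 - a1" using that m by presburger
      then show ?thesis using True assms by (auto simp: f_def region_def)
    next
      case False
      then have "int (j div 2) < c2 - b2 - a1 - 1" using that m by presburger
      then show ?thesis using False assms by (auto simp: f_def region_def)
    qed
    ultimately show "x \<in> region a1 a2 b1 (b2 + 1) c1 c2" by (auto simp: region_def)
  qed
  ultimately show ?thesis unfolding bar_def alongside_def by blast
qed

lemma bar_a1:
  assumes "a1 < a2" "b2 + a1 \<le> c2" "b1 \<le> c1 - a1" and m: "int m = 2 * (b2 + a1 - c1) - 1"
  shows "bar (region a1 a2 b1 b2 c1 c2) m (region (a1 - 1) a2 b1 b2 c1 c2)"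
  using bar_rot[OF bar_b2[of "- a2" "- a1" b2 c2 b1 c1 m]] assms by (simp add: rot_region)

lemma bar_c1:
  assumes "c1 < c2" "c1 - a1 \<le> b2" "c1 \<le> a2 + b1" and m: "int m = 2 * (c1 - a1 - b1) - 1"
  shows "bar (region a1 a2 b1 b2 c1 c2) m (region a1 a2 b1 b2 (c1 - 1) c2)"
  using bar_rot[OF bar_a1[of c1 c2 "- a1" b2 "- a2" b1 m]] assms by (simp add: rot_region)

lemma bar_b1:
  assumes "b1 < b2" "a1 + b1 \<le> c1" "b1 \<le> c2 - a2" and m: "int m = 2 * (a2 + b1 - c1) - 1"
  shows "bar (region a1 a2 b1 b2 c1 c2) m (region a1 a2 (b1 - 1) b2 c1 c2)"
  using bar_rot[OF bar_c1[of b1 b2 c1 "- a1" c2 "- a2" m]] assms by (simp add: rot_region)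

lemma bar_a2:
  assumes "a1 < a2" "c1 - a2 \<le> b1" "c2 \<le> a2 + b2" and m: "int m = 2 * (c2 - a2 - b1) - 1"
  shows "bar (region a1 a2 b1 b2 c1 c2) m (region a1 (a2 + 1) b1 b2 c1 c2)"
  using bar_rot[OF bar_b1[of "- a2" "- a1" c1 b1 b2 c2 m]] assms by (simp add: rot_region algebra_simps)

lemma bar_c2:
  assumes "c1 < c2" "a2 + b1 \<le> c2" "a1 + b2 \<le> c2" and m: "int m = 2 * (a2 + b2 - c2) - 1"
  shows "bar (region a1 a2 b1 b2 c1 c2) m (region a1 a2 b1 b2 c1 (c2 + 1))"
  using bar_rot[OF bar_a2[of c1 c2 b1 "- a2" b2 "- a1" m]] assms by (simp add: rot_region algebra_simps)

section \<open>Cardinality and perimeter while a bar is filled\<close>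

lemma walk_shift: "walk f \<Longrightarrow> walk (\<lambda>i. f (i + n))"
  unfolding walk_def inj_def by (metis add_Suc add_right_cancel)

lemma walk_leaves_finite:
  assumes "walk f" "finite A"
  shows "\<exists>k. f k \<notin> A"
proof (rule ccontr)
  assume "\<not> (\<exists>k. f k \<notin> A)"
  then have "finite (range f)" using assms(2) by (metis finite_subset image_subset_iff)
  then show False using assms(1) finite_imageD[of f UNIV] by (auto simp: walk_def)
qed

text \<open>The first face touches \<open>K\<close> and each face of odd index touches its
  predecessor, so each adds at most one to the perimeter. A later face of even index touches both,
  so the perimeter drops by at least one. Hence the pattern 0, 1, 2, 1, 2, ...\<close>

lemma alongside_partial:
  assumes f: "alongside K m f" and fin: "finite K" and j: "j \<le> m"
  shows "card (K \<union> f ` {..<j}) = card K + j"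
    and "per (K \<union> f ` {..<j}) \<le> per K + (if j = 0 then 0 else if odd j then 1 else 2)"
proof -
  have inj: "inj f" and disj: "\<And>i. f i \<notin> K" using f by (auto simp: alongside_def walk_def)
  show "card (K \<union> f ` {..<j}) = card K + j"
    using fin disj inj by (subst card_Un_disjoint) (auto simp: card_image inj_on_def inj_def)
  show "per (K \<union> f ` {..<j}) \<le> per K + (if j = 0 then 0 else if odd j then 1 else 2)"
    using j
  proof (induction j)
    case (Suc j)
    let ?A = "K \<union> f ` {..<j}"
    have eq: "K \<union> f ` {..<Suc j} = insert (f j) ?A" by (auto simp: lessThan_Suc)
    have new: "f j \<notin> ?A" using disj inj by (auto simp: inj_def)
    have ins: "per (insert (f j) ?A) + 2 * deg ?A (f j) = per ?A + 3"
      using fin new by (intro per_insert) auto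
    have prev: "f (j - 1) \<in> nbrs (f j) \<inter> ?A" if pos: "j > 0"
    proof -
      obtain i where i: "j = Suc i" using pos by (cases j) auto
      then have "f j \<in> nbrs (f i)" using f by (auto simp: alongside_def walk_def)
      then show ?thesis using i nbrs_sym by auto
    qed
    show ?case
    proof (cases "even j \<and> j > 0")
      case True
      then have "nbrs (f j) \<inter> K \<noteq> {}" using f Suc.prems by (simp add: alongside_def)
      then obtain y where y: "y \<in> nbrs (f j) \<inter> K" by blast
      then have "card {y, f (j - 1)} = 2" using disj by (auto simp: card_insert_if)
      moreover have "{y, f (j - 1)} \<subseteq> nbrs (f j) \<inter> ?A" using prev True y by auto
      then have "card {y, f (j - 1)} \<le> deg ?A (f j)" unfolding deg_def by (intro card_mono) auto
      ultimately show ?thesis using ins Suc True unfolding eq by auto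
    next
      case False
      have "nbrs (f j) \<inter> ?A \<noteq> {}"
      proof (cases "even j")
        case True
        then have "nbrs (f j) \<inter> K \<noteq> {}" using f Suc.prems by (simp add: alongside_def)
        then show ?thesis by blast
      next
        case False
        then show ?thesis using prev by (metis empty_iff gr_zeroI even_zero)
      qed
      then have "deg ?A (f j) \<ge> 1" by (simp add: deg_def Suc_le_eq card_gt_0_iff)
      then show ?thesis using ins Suc False unfolding eq by (cases "j = 0") auto
    qed
  qed simp
qed

lemma bar_card_per:
  assumes "bar K m K'" "finite K" "odd m"
  shows "finite K'" "K \<subseteq> K'" "card K' = card K + m" "per K' \<le> per K + 1"
proof -
  obtain f where f: "alongside K m f" "K' = K \<union> f ` {..<m}" using assms(1) by (auto simp: bar_def)
  then show "finite K'" "K \<subseteq> K'" using assms(2) by auto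
  show "card K' = card K + m" "per K' \<le> per K + 1"
    using alongside_partial[OF f(1) assms(2), of m] f(2) assms(3) odd_pos[OF assms(3)] by auto
qed

subsection \<open>From a hexagon to the next one\<close>

text \<open>A side of length \<open>l\<close> carries a bar of \<open>2 * l - 1\<close> faces; the
  sides met during one turn have lengths \<open>R\<close>, four times \<open>R + 1\<close>, and
  \<open>R + 2\<close>.\<close>

definition bar_length :: "nat \<Rightarrow> nat \<Rightarrow> nat" where
  "bar_length R i = (if i = 0 then 2 * R - 1 else if i = 5 then 2 * R + 3 else 2 * R + 1)"

definition turn :: "nat \<Rightarrow> (nat \<Rightarrow> site set) \<Rightarrow> bool" where
  "turn R B \<longleftrightarrow> (\<forall>i<6. bar (B i) (bar_length R i) (B (Suc i)))"

lemma all_less_6: "(\<forall>i<6. P i) \<longleftrightarrow> P 0 \<and> P 1 \<and> P 2 \<and> P 3 \<and> P 4 \<and> P (5::nat)"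
  by (simp add: numeral_eq_Suc All_less_Suc2)

lemma turn_rot: "turn R B \<Longrightarrow> turn R (\<lambda>i. rot ` B i)"
  by (simp add: turn_def bar_rot)

text \<open>
  The center moves towards a vertex of the hexagon: the two sides at that vertex are moved twice,
  the two sides next to them once, and the remaining two sides stay where they are.
\<close>

lemma turn_Hex_e1:
  assumes "R \<ge> 1"
  shows "\<exists>B. turn R B \<and> B 0 = Hex R p q \<and> B 6 = Hex (Suc R) (p + 1) q"
proof -
  define a1 b1 c1 where "a1 = p - int R" and "b1 = q - int R" and "c1 = p + q - int R"
  define a2 b2 c2 where "a2 = p + int R" and "b2 = q + int R" and "c2 = p + q + int R"
  note defs = a1_def b1_def c1_def a2_def b2_def c2_def
  \<comment> \<open>The order of the sides \<open>a2\<close>, \<open>c2\<close>, \<open>b2\<close>,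
    \<open>c2\<close>, \<open>a2\<close>, \<open>b1\<close> matters: each side must have reached the
    length required by \<open>bar_length\<close> when its turn comes.\<close>
  define B where "B = (!) [region a1 a2 b1 b2 c1 c2, region a1 (a2 + 1) b1 b2 c1 c2,
    region a1 (a2 + 1) b1 b2 c1 (c2 + 1), region a1 (a2 + 1) b1 (b2 + 1) c1 (c2 + 1),
    region a1 (a2 + 1) b1 (b2 + 1) c1 (c2 + 2), region a1 (a2 + 2) b1 (b2 + 1) c1 (c2 + 2),
    region a1 (a2 + 2) (b1 - 1) (b2 + 1) c1 (c2 + 2)]"
  have len: "int (2 * R - 1) = 2 * int R - 1" using assms by auto
  have "bar (B 0) (2 * R - 1) (B 1)"
    using bar_a2[of a1 a2 c1 b1 c2 b2 "2 * R - 1"] assms len by (simp add: B_def defs)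
  moreover have "bar (B 1) (2 * R + 1) (B 2)"
    using bar_c2[of c1 c2 "a2 + 1" b1 a1 b2 "2 * R + 1"] assms by (simp add: B_def defs numeral_eq_Suc)
  moreover have "bar (B 2) (2 * R + 1) (B 3)"
    using bar_b2[of b1 b2 "c2 + 1" "a2 + 1" c1 a1 "2 * R + 1"] assms by (simp add: B_def defs numeral_eq_Suc)
  moreover have "bar (B 3) (2 * R + 1) (B 4)"
    using bar_c2[of c1 "c2 + 1" "a2 + 1" b1 a1 "b2 + 1" "2 * R + 1"] assms
    by (simp add: B_def defs numeral_eq_Suc algebra_simps)
  moreover have "bar (B 4) (2 * R + 1) (B 5)"
    using bar_a2[of a1 "a2 + 1" c1 b1 "c2 + 2" "b2 + 1" "2 * R + 1"] assms
    by (simp add: B_def defs numeral_eq_Suc algebra_simps)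
  moreover have "bar (B 5) (2 * R + 3) (B 6)"
    using bar_b1[of b1 "b2 + 1" a1 c1 "c2 + 2" "a2 + 2" "2 * R + 3"] assms
    by (simp add: B_def defs numeral_eq_Suc)
  ultimately have "turn R B"
    unfolding turn_def all_less_6 by (simp add: bar_length_def numeral_eq_Suc)
  moreover have "B 0 = Hex R p q" "B 6 = Hex (Suc R) (p + 1) q"
    by (simp_all add: B_def defs Hex_def numeral_eq_Suc algebra_simps)
  ultimately show ?thesis by blast
qed

definition unit_vectors :: "(int \<times> int) set" where
  "unit_vectors = {(1, 0), (0, 1), (-1, 1), (-1, 0), (0, -1), (1, -1)}"

lemma turn_Hex:
  assumes R: "R \<ge> 1" and uv: "(u, v) \<in> unit_vectors"
  shows "\<exists>B. turn R B \<and> B 0 = Hex R p q \<and> B 6 = Hex (Suc R) (p + u) (q + v)"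
proof -
  define D where "D u v \<longleftrightarrow> (\<forall>p q. \<exists>B. turn R B \<and> B 0 = Hex R p q \<and> B 6 = Hex (Suc R) (p + u) (q + v))" for u v
  have step: "D (- v) (u + v)" if D: "D u v" for u v
    unfolding D_def
  proof (intro allI)
    fix p q
    obtain B where "turn R B" "B 0 = Hex R (p + q) (- p)" "B 6 = Hex (Suc R) (p + q + u) (- p + v)"
      using D unfolding D_def by blast
    then show "\<exists>B. turn R B \<and> B 0 = Hex R p q \<and> B 6 = Hex (Suc R) (p + - v) (q + (u + v))"
      by (intro exI[of _ "\<lambda>i. rot ` B i"]) (simp add: turn_rot rot_Hex algebra_simps)
  qed
  have 1: "D 1 0" unfolding D_def using turn_Hex_e1[OF R] by simp
  have 2: "D 0 1" using step[OF 1] by simp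
  have 3: "D (-1) 1" using step[OF 2] by simp
  have 4: "D (-1) 0" using step[OF 3] by simp
  have 5: "D 0 (-1)" using step[OF 4] by simp
  have 6: "D 1 (-1)" using step[OF 5] by simp
  show ?thesis using 1 2 3 4 5 6 uv unfolding unit_vectors_def D_def by auto
qed

text \<open>It allows going backwards: from a hexagon containing \<open>x\<close>, some admissible
  predecessor of radius one less still contains \<open>x\<close>.\<close>

lemma Hex_cover:
  assumes "x \<in> Hex (Suc R) p q" "R \<ge> 1"
  shows "\<exists>(u, v)\<in>unit_vectors. x \<in> Hex R (p - u) (q - v)"
proof -
  define a b c r where "a = ca x - p" and "b = cb x - q" and "c = cc x - p - q" and "r = int R"
  have mem: "x \<in> Hex R (p - u) (q - v) \<longleftrightarrow>
      - r \<le> a + u \<and> a + u < r \<and> - r \<le> b + v \<and> b + v < r \<and> - r \<le> c + u + v \<and> c + u + v < r" for u v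
    by (auto simp: Hex_def region_def a_def b_def c_def r_def)
  have "- r - 1 \<le> a" "a < r + 1" "- r - 1 \<le> b" "b < r + 1" "- r - 1 \<le> c" "c < r + 1"
    using assms(1) by (auto simp: Hex_def region_def a_def b_def c_def r_def)
  moreover have "c = a + b \<or> c = a + b + 1" using cc_cases[of x] by (auto simp: a_def b_def c_def)
  moreover have "r \<ge> 1" using assms(2) by (simp add: r_def)
  ultimately have "(- r \<le> a + 1 \<and> a + 1 < r \<and> - r \<le> b + 0 \<and> b + 0 < r \<and> - r \<le> c + 1 + 0 \<and> c + 1 + 0 < r)
     \<or> (- r \<le> a + 0 \<and> a + 0 < r \<and> - r \<le> b + 1 \<and> b + 1 < r \<and> - r \<le> c + 0 + 1 \<and> c + 0 + 1 < r)
     \<or> (- r \<le> a + -1 \<and> a + -1 < r \<and> - r \<le> b + 1 \<and> b + 1 < r \<and> - r \<le> c + -1 + 1 \<and> c + -1 + 1 < r)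
     \<or> (- r \<le> a + -1 \<and> a + -1 < r \<and> - r \<le> b + 0 \<and> b + 0 < r \<and> - r \<le> c + -1 + 0 \<and> c + -1 + 0 < r)
     \<or> (- r \<le> a + 0 \<and> a + 0 < r \<and> - r \<le> b + -1 \<and> b + -1 < r \<and> - r \<le> c + 0 + -1 \<and> c + 0 + -1 < r)
     \<or> (- r \<le> a + 1 \<and> a + 1 < r \<and> - r \<le> b + -1 \<and> b + -1 < r \<and> - r \<le> c + 1 + -1 \<and> c + 1 + -1 < r)"
    by (smt (z3))
  then show ?thesis by (simp add: unit_vectors_def mem)
qed

section \<open>Nested hexagons around a prescribed site\<close>

inductive grows :: "site \<Rightarrow> nat \<Rightarrow> site set \<Rightarrow> bool" for x where
  grows_1: "x \<in> Hex 1 p q \<Longrightarrow> grows x 1 (Hex 1 p q)"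
| grows_Suc: "grows x R (B 0) \<Longrightarrow> turn R B \<Longrightarrow> grows x (Suc R) (B 6)"

lemma grows_Hex: "R \<ge> 1 \<Longrightarrow> x \<in> Hex R p q \<Longrightarrow> grows x R (Hex R p q)"
proof (induction R arbitrary: p q rule: nat_induct_at_least)
  case base
  then show ?case using grows_1 by simp
next
  case (Suc R)
  then obtain u v where uv: "(u, v) \<in> unit_vectors" "x \<in> Hex R (p - u) (q - v)"
    using Hex_cover by blast
  obtain B where B: "turn R B" "B 0 = Hex R (p - u) (q - v)" "B 6 = Hex (Suc R) (p - u + u) (q - v + v)"
    using turn_Hex[OF Suc.hyps uv(1)] by blast
  have "grows x R (B 0)" using Suc.IH[OF uv(2)] B by simp
  from grows_Suc[OF this B(1)] show ?case using B(3) by simp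
qed

definition bars_total :: "nat \<Rightarrow> nat \<Rightarrow> nat" where
  "bars_total R i = (\<Sum>k<i. bar_length R k)"

lemma Hex_1_eq: "Hex 1 p q = {Up p q, Down (p - 1) q, Up (p - 1) q, Down (p - 1) (q - 1), Up p (q - 1), Down p (q - 1)}"
proof -
  have "x \<in> Hex 1 p q \<longleftrightarrow> x \<in> {Up p q, Down (p - 1) q, Up (p - 1) q, Down (p - 1) (q - 1), Up p (q - 1), Down p (q - 1)}" for x
    by (cases x; simp add: Hex_def region_def; linarith)
  then show ?thesis by blast
qed

lemma card_Hex_1: "card (Hex 1 p q) = 6"
  unfolding Hex_1_eq by (simp add: card_insert_if)

lemma per_Hex_1: "per (Hex 1 p q) \<le> 6"
proof -
  have "per (Hex 1 p q) = (\<Sum>x\<in>Hex 1 p q. card (nbrs x - Hex 1 p q))" by (simp add: per_sum)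
  also have "\<dots> \<le> (\<Sum>x\<in>Hex 1 p q. 1)"
  proof (rule sum_mono)
    fix x assume "x \<in> Hex 1 p q"
    then have "\<exists>y. nbrs x - Hex 1 p q \<subseteq> {y}"
      unfolding Hex_1_eq by (elim insertE; simp add: insert_Diff_if) (blast+)?
    then obtain y where "nbrs x - Hex 1 p q \<subseteq> {y}" by blast
    then show "card (nbrs x - Hex 1 p q) \<le> 1"
      using card_mono[of "{y}" "nbrs x - Hex 1 p q"] by simp
  qed
  also have "\<dots> = 6" using card_Hex_1[of p q] by simp
  finally show ?thesis .
qed

lemma turn_card_per:
  assumes "turn R B" "finite (B 0)" "R \<ge> 1" "i \<le> 6"
  shows "finite (B i) \<and> B 0 \<subseteq> B i \<and> card (B i) = card (B 0) + bars_total R i \<and> per (B i) \<le> per (B 0) + i"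
  using assms(4)
proof (induction i)
  case (Suc i)
  then have "bar (B i) (bar_length R i) (B (Suc i))" using assms(1) by (simp add: turn_def)
  moreover have "odd (bar_length R i)" using assms(3) by (simp add: bar_length_def)
  ultimately show ?case using bar_card_per Suc by (fastforce simp: bars_total_def)
qed (simp add: bars_total_def assms(2))

lemma turn_mono:
  assumes "turn R B" "finite (B 0)" "R \<ge> 1" "i \<le> 6"
  shows "B i \<subseteq> B 6"
  using assms(4)
proof (induction rule: inc_induct)
  case (step i)
  then have "bar (B i) (bar_length R i) (B (Suc i))" using assms(1) by (simp add: turn_def)
  then have "B i \<subseteq> B (Suc i)" by (auto simp: bar_def)
  then show ?case using step by auto
qed simp

lemma bars_total_6: "R \<ge> 1 \<Longrightarrow> bars_total R 6 = 12 * R + 6"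
  by (simp add: bars_total_def bar_length_def numeral_eq_Suc)

lemma grows_props:
  assumes "grows x R K"
  shows "R \<ge> 1 \<and> finite K \<and> x \<in> K \<and> card K = 6 * R^2 \<and> per K \<le> 6 * R"
  using assms
proof induction
  case (grows_1 p q)
  then show ?case using per_Hex_1[of p q] card_Hex_1[of p q] by simp
next
  case (grows_Suc R B)
  then show ?case using turn_card_per[of R B 6] bars_total_6[of R]
    by (auto simp: power2_eq_square)
qed

subsection \<open>The box\<close>

text \<open>The distance is a \<open>LEAST\<close> over lengths of connecting walks, which is
  meaningful only if such a walk exists.\<close>

lemma lattice_connected: "(x, y) \<in> {(u, v). nn u v}\<^sup>*"
proof -
  let ?R = "{(u, v). nn u v}\<^sup>*"
  have sym: "(u, v) \<in> ?R \<Longrightarrow> (v, u) \<in> ?R" for u v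
    using sym_rtrancl[of "{(u, v). nn u v}"] nn_sym by (auto simp: sym_def)
  have edge: "v \<in> nbrs u \<Longrightarrow> (u, v) \<in> ?R" for u v
    using nn_iff by auto
  have a: "(Up a b, Up (a + 1) b) \<in> ?R" for a b
    by (rule rtrancl_trans[OF edge[of "Down a b"] edge]) auto
  have b: "(Up a b, Up a (b + 1)) \<in> ?R" for a b
    by (rule rtrancl_trans[OF edge[of "Down a b"] edge]) auto
  have a': "(Up 0 b, Up a b) \<in> ?R" for a b
  proof (induction a rule: int_induct[of _ 0])
    case (step1 i)
    then show ?case using a[of i b] by (auto intro: rtrancl_trans)
  next
    case (step2 i)
    then show ?case using sym[OF a[of "i - 1" b]] by (auto intro: rtrancl_trans)
  qed simp
  have b': "(Up 0 0, Up 0 b) \<in> ?R" for b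
  proof (induction b rule: int_induct[of _ 0])
    case (step1 i)
    then show ?case using b[of 0 i] by (auto intro: rtrancl_trans)
  next
    case (step2 i)
    then show ?case using sym[OF b[of 0 "i - 1"]] by (auto intro: rtrancl_trans)
  qed simp
  have "(Up 0 0, z) \<in> ?R" for z
  proof (cases z)
    case (Up a b)
    then show ?thesis using rtrancl_trans[OF b' a'] by simp
  next
    case (Down a b)
    have "(Up 0 0, Up a b) \<in> ?R" using rtrancl_trans[OF b' a'] by simp
    moreover have "(Up a b, Down a b) \<in> ?R" by (rule edge) simp
    ultimately show ?thesis using Down by (metis rtrancl_trans)
  qed
  then show ?thesis using sym by (meson rtrancl_trans)
qed

lemma lattice_dist_1_iff: "lattice_dist x y = 1 \<longleftrightarrow> y \<in> nbrs x"
proof -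
  let ?P = "\<lambda>n. (x, y) \<in> {(u, v). nn u v} ^^ n"
  have ex: "\<exists>n. ?P n" using lattice_connected[of x y] by (simp add: rtrancl_power)
  show ?thesis
  proof
    assume "lattice_dist x y = 1"
    then have "?P 1" using LeastI_ex[of ?P, OF ex] unfolding lattice_dist_def by simp
    then show "y \<in> nbrs x" by (simp add: nn_iff)
  next
    assume y: "y \<in> nbrs x"
    then have "?P 1" by (simp add: nn_iff)
    moreover have "\<not> ?P 0" using y by auto
    ultimately show "lattice_dist x y = 1"
      unfolding lattice_dist_def by (intro Least_equality) (auto simp: Suc_le_eq intro!: gr0I)
  qed
qed

lemma Box_eq: "Box L = hexagon L \<union> {x. nbrs x \<inter> hexagon L \<noteq> {}}"
  unfolding Box_def lattice_dist_1_iff by auto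

text \<open>It identifies \<open>Box_bd L\<close> with the whole layer
  \<open>Box L - hexagon L\<close>, so that every site of this layer can create and annihilate
  particles.\<close>

lemma outer_neighbor:
  assumes x: "x \<notin> hexagon L" "y \<in> nbrs x" "y \<in> hexagon L"
  shows "\<exists>z\<in>nbrs x. z \<notin> Box L"
proof -
  have out: "z \<notin> Box L" if "z \<notin> hexagon L" "\<And>w. w \<in> nbrs z \<Longrightarrow> w \<notin> hexagon L" for z
    using that unfolding Box_eq by blast
  note mem = hexagon_eq_Hex Hex_def region_def
  show ?thesis
  proof (cases x)
    case (Up a b)
    show ?thesis
    proof (cases "y = Down a b")
      case True
      have "Down (a - 1) b \<notin> Box L" using x True Up by (intro out) (auto simp: mem)
      then show ?thesis using Up by auto
    next
      case False
      have "Down a b \<notin> Box L" using x False Up by (intro out) (auto simp: mem)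
      then show ?thesis using Up by auto
    qed
  next
    case (Down a b)
    show ?thesis
    proof (cases "y = Up a b")
      case True
      have "Up (a + 1) b \<notin> Box L" using x True Down by (intro out) (auto simp: mem)
      then show ?thesis using Down by auto
    next
      case False
      have "Up a b \<notin> Box L" using x False Down by (intro out) (auto simp: mem)
      then show ?thesis using Down by auto
    qed
  qed
qed

lemma Box_bd_eq: "Box_bd L = Box L - hexagon L"
proof -
  have "x \<notin> Box_bd L" if "x \<in> hexagon L" for x
    using that nbrs_sym unfolding Box_bd_def lattice_dist_1_iff Box_eq by blast
  moreover have "x \<in> Box_bd L" if x: "x \<in> Box L" "x \<notin> hexagon L" for x
  proof -
    obtain y where "y \<in> nbrs x" "y \<in> hexagon L" using x by (auto simp: Box_eq)
    then obtain z where "z \<in> nbrs x" "z \<notin> Box L" using outer_neighbor x by blast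
    then show ?thesis
      using x(1) nbrs_sym[of x z] unfolding Box_bd_def lattice_dist_1_iff by blast
  qed
  ultimately show ?thesis by (auto simp: Box_bd_def)
qed

lemma Box_int_eq: "Box_int L = hexagon L"
  by (auto simp: Box_int_def Box_bd_eq Box_eq)

lemma hexagon_subset_Box: "hexagon L \<subseteq> Box L"
  by (auto simp: Box_eq)

lemma Box_bd_outer_neighbor: "x \<in> Box_bd L \<Longrightarrow> \<exists>z\<in>nbrs x. z \<notin> Box L"
  using outer_neighbor[of x L] by (auto simp: Box_bd_eq Box_eq)

lemma nbr_of_hexagon: "x \<in> hexagon L \<Longrightarrow> y \<in> nbrs x \<Longrightarrow> y \<notin> hexagon L \<Longrightarrow> y \<in> Box_bd L"
  using nbrs_sym[of y x] by (auto simp: Box_bd_eq Box_eq)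

lemma finite_Box [simp]: "finite (Box L)"
proof (rule finite_subset)
  show "Box L \<subseteq> hexagon L \<union> (\<Union>y\<in>hexagon L. nbrs y)"
    using nbrs_sym by (auto simp: Box_eq)
qed simp

subsection \<open>Configurations as sets of occupied sites\<close>

definition conf :: "nat \<Rightarrow> site set \<Rightarrow> config" where
  "conf L S = (\<lambda>x\<in>Box L. if x \<in> S then 1 else 0)"

lemma configs_eq: "configs L = conf L ` Pow (Box L)"
proof -
  have "\<eta> = conf L {x \<in> Box L. \<eta> x = 1}" if "\<eta> \<in> configs L" for \<eta>
    using that unfolding configs_def conf_def by (auto simp: fun_eq_iff PiE_def Pi_def extensional_def)
  moreover have "conf L S \<in> configs L" for S
    by (auto simp: configs_def conf_def)
  ultimately show ?thesis by blast
qed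

lemma conf_eqD: "conf L S = conf L T \<Longrightarrow> S \<subseteq> Box L \<Longrightarrow> T \<subseteq> Box L \<Longrightarrow> S = T"
  by (auto simp: conf_def fun_eq_iff split: if_splits)

lemma finite_configs [simp]: "finite (configs L)"
  by (simp add: configs_eq)

lemma config_empty_eq: "config_empty L = conf L {}"
  by (simp add: config_empty_def conf_def)

lemma config_full_eq: "config_full L = conf L (hexagon L)"
  by (auto simp: config_full_def conf_def Box_int_eq)

lemma hamiltonian_conf:
  assumes S: "S \<subseteq> Box L"
  shows "hamiltonian L U \<Delta> (conf L S) = \<Delta> * real (card S) - U * real (bonds (S \<inter> hexagon L))"
proof -
  have "(\<Sum>x\<in>Box L. real (conf L S x)) = (\<Sum>x\<in>Box L. if x \<in> S then 1 else 0)"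
    by (intro sum.cong) (auto simp: conf_def)
  also have "\<dots> = real (card S)" using S by (simp add: sum.If_cases Int_absorb1)
  finally have 1: "(\<Sum>x\<in>Box L. real (conf L S x)) = real (card S)" .
  have fin: "finite (pairs L)"
    by (rule finite_subset[of _ "Pow (hexagon L)"]) (auto simp: pairs_def Box_int_eq)
  have "(\<Sum>e\<in>pairs L. \<Prod>x\<in>e. real (conf L S x)) = (\<Sum>e\<in>pairs L. if e \<subseteq> S then 1 else 0)"
  proof (intro sum.cong refl)
    fix e assume "e \<in> pairs L"
    then obtain x y where e: "e = {x, y}" "x \<in> hexagon L" "y \<in> hexagon L" "y \<in> nbrs x"
      by (auto simp: pairs_def Box_int_eq nn_iff)
    then have "x \<noteq> y" "x \<in> Box L" "y \<in> Box L" using hexagon_subset_Box by auto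
    then show "(\<Prod>x\<in>e. real (conf L S x)) = (if e \<subseteq> S then 1 else 0)" using e by (simp add: conf_def)
  qed
  also have "\<dots> = real (card {e \<in> pairs L. e \<subseteq> S})"
    using fin by (simp add: sum.If_cases Int_def)
  also have "card {e \<in> pairs L. e \<subseteq> S} = bonds (S \<inter> hexagon L)"
    unfolding bonds_def
  proof (rule bij_betw_same_card[symmetric, of "\<lambda>(x, y). {x, y}"], unfold bij_betw_def, intro conjI)
    have "p = q" if pq: "p \<in> up_bonds (S \<inter> hexagon L)" "q \<in> up_bonds (S \<inter> hexagon L)"
      "(\<lambda>(x, y). {x, y}) p = (\<lambda>(x, y). {x, y}) q" for p q
    proof -
      obtain x y z w where "p = (x, y)" "q = (z, w)" by (metis surj_pair)
      then show ?thesis using pq is_Up_nbrs[of y x] is_Up_nbrs[of w z]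
        by (auto simp: up_bonds_def doubleton_eq_iff)
    qed
    then show "inj_on (\<lambda>(x, y). {x, y}) (up_bonds (S \<inter> hexagon L))" by (intro inj_onI)
    show "(\<lambda>(x, y). {x, y}) ` up_bonds (S \<inter> hexagon L) = {e \<in> pairs L. e \<subseteq> S}"
    proof (intro subset_antisym subsetI)
      fix e assume "e \<in> {e \<in> pairs L. e \<subseteq> S}"
      then obtain x y where e: "e = {x, y}" "x \<in> S \<inter> hexagon L" "y \<in> S \<inter> hexagon L" "y \<in> nbrs x"
        by (auto simp: pairs_def Box_int_eq nn_iff)
      then have "(x, y) \<in> up_bonds (S \<inter> hexagon L) \<or> (y, x) \<in> up_bonds (S \<inter> hexagon L)"
        using is_Up_nbrs[of y x] nbrs_sym[of x y] by (auto simp: up_bonds_def)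
      then show "e \<in> (\<lambda>(x, y). {x, y}) ` up_bonds (S \<inter> hexagon L)" using e(1) by force
    qed (auto simp: up_bonds_def pairs_def Box_int_eq nn_iff)
  qed
  finally show ?thesis using 1 by (simp add: hamiltonian_def)
qed

subsection \<open>Moves\<close>

text \<open>Only the bond moves that change the configuration, such as exchanges of a particle with
  a vacancy; a step that holds the chain in place is not a move.\<close>

definition moves :: "nat \<Rightarrow> site set \<Rightarrow> site set \<Rightarrow> bool" where
  "moves L S S' \<longleftrightarrow>
     (\<exists>x\<in>Box L. \<exists>y\<in>Box L. y \<in> nbrs x \<and> x \<in> S \<and> y \<notin> S \<and> S' = insert y (S - {x}))
     \<or> (\<exists>x\<in>Box_bd L. x \<in> S \<and> S' = S - {x}) \<or> (\<exists>x\<in>Box_bd L. x \<notin> S \<and> S' = insert x S)"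

lemma Box_bd_subset: "Box_bd L \<subseteq> Box L"
  by (auto simp: Box_bd_def)

lemma finite_oriented_bonds [simp]: "finite (oriented_bonds L)"
proof (rule finite_subset)
  show "oriented_bonds L \<subseteq> Sigma (Box L) nbrs \<union> prod.swap ` Sigma (Box L) nbrs"
  proof
    fix b assume "b \<in> oriented_bonds L"
    then obtain x y where "b = (x, y)" "y \<in> nbrs x" "x \<in> Box L \<or> y \<in> Box L"
      using Box_bd_subset by (auto simp: oriented_bonds_def nn_iff)
    then show "b \<in> Sigma (Box L) nbrs \<union> prod.swap ` Sigma (Box L) nbrs"
      using nbrs_sym[of x y] by (auto simp: image_iff)
  qed
qed simp

lemma kawasaki_off_diag_pos_iff:
  "kawasaki_off_diag L U \<Delta> \<beta> \<eta> \<eta>' > 0 \<longleftrightarrow> (\<exists>b\<in>oriented_bonds L. \<eta>' = bond_move L b \<eta>)"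
  unfolding kawasaki_off_diag_def
  by (auto simp: card_gt_0_iff intro!: divide_pos_pos)

lemma moves_iff_bond_move:
  assumes S: "S \<subseteq> Box L" and S': "S' \<subseteq> Box L"
  shows "moves L S S' \<longleftrightarrow> S \<noteq> S' \<and> (\<exists>b\<in>oriented_bonds L. conf L S' = bond_move L b (conf L S))"
proof
  assume "moves L S S'"
  then consider (swap) x y where "x \<in> Box L" "y \<in> Box L" "y \<in> nbrs x" "x \<in> S" "y \<notin> S" "S' = insert y (S - {x})"
    | (remove) x where "x \<in> Box_bd L" "x \<in> S" "S' = S - {x}"
    | (create) x where "x \<in> Box_bd L" "x \<notin> S" "S' = insert x S"
    unfolding moves_def by blast
  then show "S \<noteq> S' \<and> (\<exists>b\<in>oriented_bonds L. conf L S' = bond_move L b (conf L S))"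
  proof cases
    case swap
    then have "(x, y) \<in> oriented_bonds L" by (simp add: oriented_bonds_def nn_iff)
    moreover have "conf L S' = bond_move L (x, y) (conf L S)"
      using swap by (auto simp: bond_move_def conf_def fun_eq_iff)
    ultimately show ?thesis using swap by blast
  next
    case remove
    then obtain z where z: "z \<in> nbrs x" "z \<notin> Box L" using Box_bd_outer_neighbor by blast
    then have "(x, z) \<in> oriented_bonds L" using remove by (simp add: oriented_bonds_def nn_iff)
    moreover have "conf L S' = bond_move L (x, z) (conf L S)"
      using remove z Box_bd_subset by (auto simp: bond_move_def conf_def fun_eq_iff)
    ultimately show ?thesis using remove by blast
  next
    case create
    then obtain z where z: "z \<in> nbrs x" "z \<notin> Box L" using Box_bd_outer_neighbor by blast
    then have "(z, x) \<in> oriented_bonds L" using create nbrs_sym[of z x] by (simp add: oriented_bonds_def nn_iff)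
    moreover have "conf L S' = bond_move L (z, x) (conf L S)"
      using create z Box_bd_subset by (auto simp: bond_move_def conf_def fun_eq_iff)
    ultimately show ?thesis using create by blast
  qed
next
  assume "S \<noteq> S' \<and> (\<exists>b\<in>oriented_bonds L. conf L S' = bond_move L b (conf L S))"
  then obtain x y where ne: "S \<noteq> S'" and b: "(x, y) \<in> oriented_bonds L"
    and eq: "conf L S' = bond_move L (x, y) (conf L S)" by auto
  have mem: "z \<in> T \<longleftrightarrow> conf L T z = 1" if "z \<in> Box L" for z T using that by (simp add: conf_def)
  have nb: "y \<in> nbrs x" "x \<in> nbrs y" using b nbrs_sym[of x y] by (auto simp: oriented_bonds_def nn_iff)
  consider (swap) "x \<in> Box L" "y \<in> Box L" | (remove) "x \<in> Box_bd L" "y \<notin> Box L"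
    | (create) "x \<notin> Box L" "y \<in> Box_bd L"
    using b by (auto simp: oriented_bonds_def)
  then show "moves L S S'"
  proof cases
    case swap
    have eq': "z \<in> S' \<longleftrightarrow> (if z = y then x \<in> S else if z = x then y \<in> S else z \<in> S)" if "z \<in> Box L" for z
      using that swap unfolding mem[OF that] eq by (auto simp: bond_move_def conf_def)
    have eq'': "z \<in> S' \<longleftrightarrow> (if z = y then x \<in> S else if z = x then y \<in> S else z \<in> S)" for z
      using eq'[of z] S S' swap by auto
    consider "x \<in> S" "y \<notin> S" | "x \<notin> S" "y \<in> S"
    proof -
      have "\<exists>z. \<not> (z \<in> S \<longleftrightarrow> z \<in> S')" using ne by blast
      then show thesis using eq'' that by (metis (full_types))
    qed
    then show ?thesis
    proof cases
      case 1
      then have "z \<in> S' \<longleftrightarrow> z \<in> insert y (S - {x})" for z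
        using eq''[of z] nb by (cases "z = x"; cases "z = y") auto
      then have "S' = insert y (S - {x})" by blast
      then show ?thesis using \<open>x \<in> S\<close> \<open>y \<notin> S\<close> swap nb unfolding moves_def by blast
    next
      case 2
      then have "z \<in> S' \<longleftrightarrow> z \<in> insert x (S - {y})" for z
        using eq''[of z] nb by (cases "z = x"; cases "z = y") auto
      then have "S' = insert x (S - {y})" by blast
      then show ?thesis using \<open>x \<notin> S\<close> \<open>y \<in> S\<close> swap nb unfolding moves_def by blast
    qed
  next
    case remove
    then have x: "x \<in> Box L" using Box_bd_subset by auto
    have "conf L S' = conf L (S - {x})"
      using remove x unfolding eq by (auto simp: bond_move_def conf_def fun_eq_iff)
    then have "S' = S - {x}" using S S' by (intro conf_eqD) auto
    then show ?thesis using ne remove unfolding moves_def by blast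
  next
    case create
    then have y: "y \<in> Box L" using Box_bd_subset by auto
    have "conf L S' = conf L (insert y S)"
      using create y unfolding eq by (auto simp: bond_move_def conf_def fun_eq_iff)
    then have "S' = insert y S" using S S' y by (intro conf_eqD) auto
    then show ?thesis using ne create unfolding moves_def by blast
  qed
qed

lemma kawasaki_pos_iff_moves:
  assumes "S \<subseteq> Box L" "S' \<subseteq> Box L" "S \<noteq> S'"
  shows "kawasaki L U \<Delta> \<beta> (conf L S) (conf L S') > 0 \<longleftrightarrow> moves L S S'"
  using assms conf_eqD[of L S S'] kawasaki_off_diag_pos_iff moves_iff_bond_move[OF assms(1,2)]
  by (auto simp: kawasaki_def)

lemma moves_subset_Box: "moves L S S' \<Longrightarrow> S \<subseteq> Box L \<Longrightarrow> S' \<subseteq> Box L"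
  unfolding moves_def using Box_bd_subset by auto

subsection \<open>Communication heights\<close>

lemma Max_energy_paths:
  assumes "finite X" "\<omega> \<in> paths X P \<sigma> \<eta>"
  shows "Max (H ` set \<omega>) \<in> H ` X"
proof -
  have "\<omega> \<noteq> []" "set \<omega> \<subseteq> X" using assms by (auto simp: paths_def)
  moreover from this have "Max (H ` set \<omega>) \<in> H ` set \<omega>" by (intro Max_in) auto
  ultimately show ?thesis by blast
qed

text \<open>There are infinitely many paths, but their heights are among the finitely many energies;
  this gives meaning to the \<open>Min\<close> over paths.\<close>

lemma finite_path_heights: "finite X \<Longrightarrow> finite ((\<lambda>\<omega>. Max (H ` set \<omega>)) ` paths X P \<sigma> \<eta>)"
  by (rule finite_subset[of _ "H ` X"]) (auto intro: Max_energy_paths)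

lemma comm_height_le:
  assumes "finite X" "\<omega> \<in> paths X P \<sigma> \<eta>" "\<And>\<zeta>. \<zeta> \<in> set \<omega> \<Longrightarrow> H \<zeta> \<le> h"
  shows "comm_height X P H \<sigma> \<eta> \<le> h"
proof -
  have "comm_height X P H \<sigma> \<eta> \<le> Max (H ` set \<omega>)"
    unfolding comm_height_def using assms by (intro Min_le finite_path_heights) auto
  also have "\<dots> \<le> h" using assms by (auto simp: paths_def)
  finally show ?thesis .
qed

text \<open>Nonemptiness is assumed because \<open>Min\<close> of the empty set is
  unspecified.\<close>

lemma comm_height_ge:
  assumes "finite X" "paths X P \<sigma> \<eta> \<noteq> {}" "\<And>\<omega>. \<omega> \<in> paths X P \<sigma> \<eta> \<Longrightarrow> \<exists>\<zeta>\<in>set \<omega>. h \<le> H \<zeta>"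
  shows "h \<le> comm_height X P H \<sigma> \<eta>"
proof -
  have "h \<le> Max (H ` set \<omega>)" if \<omega>: "\<omega> \<in> paths X P \<sigma> \<eta>" for \<omega>
    using assms(3)[OF \<omega>] by (meson List.finite_set Max_ge finite_imageI image_eqI order_trans)
  then show ?thesis
    unfolding comm_height_def using assms(2)
    by (intro Min.boundedI finite_path_heights[OF assms(1)]) auto
qed

text \<open>Straight along a strip: \<open>cb + cc\<close> increases by one at each step, so no face
  is visited twice.\<close>

lemma exists_walk: "\<exists>f. walk f \<and> f 0 = x"
proof -
  define f where "f i = (a_fwd ^^ i) x" for i
  have "cb (a_fwd y) + cc (a_fwd y) = cb y + cc y + 1" for y by (cases y) auto
  then have "cb (f i) + cc (f i) = cb x + cc x + int i" for i
    by (induction i) (auto simp: f_def)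
  then have "inj f" unfolding inj_def by (metis add_left_cancel of_nat_eq_iff)
  moreover have "a_fwd y \<in> nbrs y" for y by (cases y) auto
  then have "f (Suc j) \<in> nbrs (f j)" for j by (simp add: f_def)
  ultimately show ?thesis unfolding walk_def by (intro exI[of _ f]) (simp add: f_def)
qed

section \<open>Energies of sets of occupied sites\<close>

locale lattice_gas =
  fixes L :: nat and U \<Delta> :: real
  assumes U_pos: "0 < U" and U_less_\<Delta>: "U < \<Delta>" and \<Delta>_less: "\<Delta> < 3 / 2 * U"
begin

definition energy :: "site set \<Rightarrow> real" where
  "energy S = \<Delta> * real (card S) - U * real (bonds (S \<inter> hexagon L))"

definition \<epsilon> :: real where "\<epsilon> = 3 * U - 2 * \<Delta>"

lemma \<epsilon>_pos: "0 < \<epsilon>"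
  using \<Delta>_less by (simp add: \<epsilon>_def)

lemma hamiltonian_energy: "S \<subseteq> Box L \<Longrightarrow> hamiltonian L U \<Delta> (conf L S) = energy S"
  by (simp add: hamiltonian_conf energy_def)

lemma finite_subset_Box: "S \<subseteq> Box L \<Longrightarrow> finite S"
  by (rule finite_subset[OF _ finite_Box])

lemma finite_subset_hexagon: "S \<subseteq> hexagon L \<Longrightarrow> finite S"
  by (rule finite_subset[OF _ finite_hexagon])

lemma energy_per:
  assumes "S \<subseteq> hexagon L"
  shows "energy S = U / 2 * real (per S) - \<epsilon> / 2 * real (card S)"
proof -
  have "real (2 * bonds S + per S) = real (3 * card S)"
    using bonds_per[OF finite_subset_hexagon[OF assms]] by simp
  then have b: "real (bonds S) = (3 * real (card S) - real (per S)) / 2" by simp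
  show ?thesis using assms by (simp add: energy_def Int_absorb2 b \<epsilon>_def field_simps)
qed

lemma energy_empty [simp]: "energy {} = 0"
  by (simp add: energy_def bonds_def up_bonds_def)

lemma energy_insert_hexagon:
  assumes "finite S" "x \<in> hexagon L" "x \<notin> S"
  shows "energy (insert x S) = energy S + \<Delta> - U * real (deg (S \<inter> hexagon L) x)"
proof -
  have "insert x S \<inter> hexagon L = insert x (S \<inter> hexagon L)" using assms by auto
  then show ?thesis using assms by (simp add: energy_def bonds_insert algebra_simps)
qed

lemma energy_insert_outside:
  assumes "finite S" "x \<notin> hexagon L" "x \<notin> S"
  shows "energy (insert x S) = energy S + \<Delta>"
  using assms by (simp add: energy_def algebra_simps)

lemma energy_insert_le:
  assumes "finite S"
  shows "energy (insert x S) \<le> energy S + \<Delta>"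
proof (cases "x \<in> S")
  case True
  then show ?thesis using U_pos U_less_\<Delta> by (simp add: insert_absorb)
next
  case False
  then show ?thesis using assms energy_insert_hexagon[of S x] energy_insert_outside[of S x] U_pos by force
qed

lemma energy_Un_le:
  assumes "finite S" "finite A"
  shows "energy (S \<union> A) \<le> energy S + \<Delta> * real (card A)"
  using assms(2)
proof induction
  case (insert x A)
  then show ?case
    using energy_insert_le[of "S \<union> A" x] assms(1) by (simp add: algebra_simps)
qed simp

lemma energy_submodular:
  assumes "S \<subseteq> hexagon L" "A \<subseteq> hexagon L"
  shows "energy (S \<union> A) + energy (S \<inter> A) \<le> energy S + energy A"
proof -
  have fin: "finite S" "finite A" using assms finite_subset_hexagon by auto
  have "real (bonds S + bonds A) \<le> real (bonds (S \<union> A) + bonds (S \<inter> A))"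
    using bonds_supermodular[OF fin] by (simp only: of_nat_le_iff)
  then have "U * real (bonds S) + U * real (bonds A) \<le> U * real (bonds (S \<union> A)) + U * real (bonds (S \<inter> A))"
    using U_pos by (simp flip: distrib_left)
  moreover have "real (card (S \<union> A)) + real (card (S \<inter> A)) = real (card S) + real (card A)"
    using card_Un_Int[OF fin] by simp
  then have "\<Delta> * real (card (S \<union> A)) + \<Delta> * real (card (S \<inter> A)) = \<Delta> * real (card S) + \<Delta> * real (card A)"
    by (simp flip: distrib_left)
  moreover have "S \<union> A \<subseteq> hexagon L" "S \<inter> A \<subseteq> hexagon L" using assms by auto
  ultimately show ?thesis using assms by (simp add: energy_def Int_absorb2)
qed

subsection \<open>Reachability below a given height\<close>

definition reach :: "real \<Rightarrow> site set \<Rightarrow> site set \<Rightarrow> bool" where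
  "reach h = (\<lambda>S S'. moves L S S' \<and> S \<subseteq> Box L \<and> energy S \<le> h \<and> energy S' \<le> h)\<^sup>*\<^sup>*"

lemma reach_refl [simp]: "reach h S S"
  by (simp add: reach_def)

lemma reach_step: "moves L S S' \<Longrightarrow> S \<subseteq> Box L \<Longrightarrow> energy S \<le> h \<Longrightarrow> energy S' \<le> h \<Longrightarrow> reach h S S'"
  unfolding reach_def by (intro r_into_rtranclp) simp

lemma reach_trans: "reach h S S' \<Longrightarrow> reach h S' S'' \<Longrightarrow> reach h S S''"
  unfolding reach_def by (rule rtranclp_trans)

lemma reach_mono: "h \<le> h' \<Longrightarrow> reach h S S' \<Longrightarrow> reach h' S S'"
  unfolding reach_def by (erule rtranclp_mono[THEN predicate2D, rotated]) auto

lemma reach_seq: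
  assumes "\<And>i. i < n \<Longrightarrow> moves L (T i) (T (Suc i))" "\<And>i. i \<le> n \<Longrightarrow> T i \<subseteq> Box L \<and> energy (T i) \<le> h"
  shows "reach h (T 0) (T n)"
  using assms
proof (induction n)
  case (Suc n)
  have "reach h (T 0) (T n)" using Suc.prems by (intro Suc.IH) auto
  moreover have "reach h (T n) (T (Suc n))" using Suc.prems by (intro reach_step) auto
  ultimately show ?case by (rule reach_trans)
qed simp

lemma reach_path:
  assumes "reach h S S'" "S \<subseteq> Box L" "energy S \<le> h"
  shows "\<exists>\<omega> \<in> paths (configs L) (kawasaki L U \<Delta> \<beta>) (conf L S) (conf L S').
           \<forall>\<zeta>\<in>set \<omega>. hamiltonian L U \<Delta> \<zeta> \<le> h"
  using assms(1) unfolding reach_def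
proof (induction rule: rtranclp_induct)
  case base
  then show ?case
    using assms by (intro bexI[of _ "[conf L S]"]) (auto simp: paths_def configs_eq hamiltonian_energy)
next
  case (step T T')
  then obtain \<omega> where \<omega>: "\<omega> \<in> paths (configs L) (kawasaki L U \<Delta> \<beta>) (conf L S) (conf L T)"
    "\<forall>\<zeta>\<in>set \<omega>. hamiltonian L U \<Delta> \<zeta> \<le> h" by blast
  have T': "T' \<subseteq> Box L" "T \<noteq> T'"
    using step moves_subset_Box moves_iff_bond_move[of T L T'] by blast+
  then have "kawasaki L U \<Delta> \<beta> (conf L T) (conf L T') > 0"
    using step kawasaki_pos_iff_moves by blast
  then have "\<omega> @ [conf L T'] \<in> paths (configs L) (kawasaki L U \<Delta> \<beta>) (conf L S) (conf L T')"
    using \<omega>(1) T' by (auto simp: paths_def configs_eq successively_append_iff)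
  moreover have "hamiltonian L U \<Delta> (conf L T') \<le> h" using step T' by (simp add: hamiltonian_energy)
  ultimately show ?case using \<omega>(2) by (intro bexI[of _ "\<omega> @ [conf L T']"]) auto
qed

lemma comm_height_le_of_reach:
  assumes "reach h S S'" "S \<subseteq> Box L" "energy S \<le> h"
  shows "comm_height (configs L) (kawasaki L U \<Delta> \<beta>) (hamiltonian L U \<Delta>) (conf L S) (conf L S') \<le> h"
  using reach_path[OF assms, of \<beta>] comm_height_le[OF finite_configs] by blast

text \<open>The number of particles can only increase by the creation of a particle outside the hexagon.\<close>

lemma path_crossing:
  assumes "successively (\<lambda>\<zeta> \<zeta>'. kawasaki L U \<Delta> \<beta> \<zeta> \<zeta>' > 0) \<omega>" "set \<omega> \<subseteq> configs L" "\<omega> \<noteq> []"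
    and "hd \<omega> = conf L S" "S \<subseteq> Box L" "card S \<le> n"
    and "last \<omega> = conf L T" "T \<subseteq> Box L" "n < card T"
    and e: "\<And>A. A \<subseteq> Box L \<Longrightarrow> card A = n \<Longrightarrow> e \<le> energy A"
  shows "\<exists>\<zeta>\<in>set \<omega>. e + \<Delta> \<le> hamiltonian L U \<Delta> \<zeta>"
  using assms(1-6,7)
proof (induction \<omega> arbitrary: S rule: induct_list012)
  case (2 \<zeta>)
  then have "S = T" using assms(8) by (intro conf_eqD) auto
  then show ?case using 2 assms(9) by simp
next
  case (3 \<zeta> \<zeta>' \<omega>)
  have "\<zeta>' \<in> configs L" using 3 by simp
  then obtain S' where S': "\<zeta>' = conf L S'" "S' \<subseteq> Box L" by (auto simp: configs_eq)
  show ?case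
  proof (cases "card S' \<le> n")
    case True
    then have "\<exists>\<zeta>\<in>set (\<zeta>' # \<omega>). e + \<Delta> \<le> hamiltonian L U \<Delta> \<zeta>"
      using 3 S' by (intro "3.IH"(2)[of S']) auto
    then show ?thesis by auto
  next
    case False
    \<comment> \<open>The step passes from at most \<open>n\<close> to more than \<open>n\<close>
      particles, so it is a genuine move, namely a creation starting from exactly
      \<open>n\<close>.\<close>
    then have "S \<noteq> S'" using "3.prems" by auto
    then have "moves L S S'"
      using "3.prems" S' kawasaki_pos_iff_moves[of S L S' U \<Delta> \<beta>] by auto
    moreover have fin: "finite S" using "3.prems" finite_subset_Box by auto
    have "card (insert y (S - {x})) = card S" if "x \<in> S" "y \<notin> S" for x y
      using that fin card_Suc_Diff1[of S x] by (subst card_insert_disjoint) auto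
    moreover have "card (S - {x}) \<le> card S" for x using fin by (intro card_mono) auto
    ultimately consider "card S' \<le> card S" | x where "x \<in> Box_bd L" "x \<notin> S" "S' = insert x S"
      unfolding moves_def by (elim disjE bexE conjE) auto
    then show ?thesis
    proof cases
      case 1
      then show ?thesis using False "3.prems" by simp
    next
      case 2
      then have "card S = n" using False "3.prems" fin by simp
      moreover have "energy S' = energy S + \<Delta>"
        using 2 fin by (simp add: energy_insert_outside Box_bd_eq)
      ultimately show ?thesis using e[of S] "3.prems" S' by (auto simp: hamiltonian_energy)
    qed
  qed
qed simp

subsection \<open>Transport of particles\<close>

lemma walk_exit:
  assumes "walk f" "f 0 \<in> hexagon L"
  obtains k where "k > 0" "\<And>i. i < k \<Longrightarrow> f i \<in> hexagon L" "f k \<in> Box_bd L"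
proof -
  define k where "k = (LEAST k. f k \<notin> hexagon L)"
  have ex: "\<exists>k. f k \<notin> hexagon L" using assms walk_leaves_finite by simp
  have out: "f k \<notin> hexagon L" unfolding k_def by (rule LeastI_ex[OF ex])
  then have "k > 0" using assms(2) by (intro gr0I) auto
  moreover have inside: "f i \<in> hexagon L" if "i < k" for i using not_less_Least that unfolding k_def by blast
  moreover have "f k \<in> nbrs (f (k - 1))" using assms(1) \<open>k > 0\<close> unfolding walk_def by (metis Suc_pred')
  then have "f k \<in> Box_bd L" using inside[of "k - 1"] \<open>k > 0\<close> out nbr_of_hexagon by auto
  ultimately show ?thesis using that by blast
qed

lemma walkD: "walk f \<Longrightarrow> f i = f j \<longleftrightarrow> i = j" "walk f \<Longrightarrow> f (Suc i) \<in> nbrs (f i)" "walk f \<Longrightarrow> f i \<in> nbrs (f (Suc i))"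
  using nbrs_sym by (auto simp: walk_def inj_def)

lemma reach_create:
  assumes "S \<subseteq> Box L" "x \<in> Box_bd L" "x \<notin> S" "energy S + \<Delta> \<le> h"
  shows "reach h S (insert x S)"
proof (rule reach_step)
  show "moves L S (insert x S)" using assms unfolding moves_def by blast
  show "energy S \<le> h" using assms U_pos U_less_\<Delta> by simp
  show "energy (insert x S) \<le> h"
    using energy_insert_le[of S x] assms finite_subset_Box by fastforce
qed (fact assms)

lemma movesI:
  assumes "x \<in> Box L" "y \<in> Box L" "y \<in> nbrs x" "x \<in> S" "y \<notin> S" "S' = insert y (S - {x})"
  shows "moves L S S'"
  using assms unfolding moves_def by blast

text \<open>The particle is created where the walk leaves the hexagon and follows it backwards; a
  single extra particle never costs more than \<Delta>.\<close>

lemma transport_free: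
  assumes B: "B \<subseteq> hexagon L" and f: "walk f" "f 0 \<in> hexagon L" "range f \<inter> B = {}"
  shows "reach (energy B + \<Delta>) B (insert (f 0) B)"
proof -
  obtain k where k: "k > 0" "\<And>i. i < k \<Longrightarrow> f i \<in> hexagon L" "f k \<in> Box_bd L"
    using walk_exit[OF f(1,2)] by blast
  have in_Box: "f i \<in> Box L" if "i \<le> k" for i
    using that k hexagon_subset_Box[of L] Box_bd_subset[of L] by (cases "i = k") auto
  have BBox: "B \<subseteq> Box L" using B hexagon_subset_Box by auto
  have fB: "f i \<notin> B" for i using f(3) by auto
  have "reach (energy B + \<Delta>) B (insert (f k) B)"
    using BBox k fB by (intro reach_create) auto
  moreover have "reach (energy B + \<Delta>) (insert (f (k - 0)) B) (insert (f (k - k)) B)"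
  proof (rule reach_seq[where T = "\<lambda>i. insert (f (k - i)) B"])
    fix i assume i: "i < k"
    have "f (k - Suc i) \<in> nbrs (f (k - i))" using walkD(3)[OF f(1), of "k - Suc i"] i by (simp add: Suc_diff_Suc)
    then show "moves L (insert (f (k - i)) B) (insert (f (k - Suc i)) B)"
      using i fB in_Box walkD(1)[OF f(1)] by (intro movesI[of "f (k - i)" "f (k - Suc i)"]) auto
  next
    fix i assume "i \<le> k"
    then show "insert (f (k - i)) B \<subseteq> Box L \<and> energy (insert (f (k - i)) B) \<le> energy B + \<Delta>"
      using in_Box BBox energy_insert_le finite_subset_Box by auto
  qed
  ultimately show ?thesis using reach_trans by simp
qed

text \<open>Compared with \<open>B\<close>, one particle has moved from \<open>f i\<close> to
  \<open>f 0\<close>. It loses at most three bonds, fewer if its neighbor \<open>f 0\<close> (for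
  \<open>i = 1\<close>) or \<open>f j\<close> (for \<open>Suc i = j\<close>) is vacant, and for
  \<open>i \<noteq> 1\<close> it gains the bond between \<open>f 0\<close> and
  \<open>f 1\<close>.\<close>

lemma energy_hole:
  assumes B: "B \<subseteq> hexagon L" and f: "walk f" "f 0 \<in> hexagon L - B" "f j \<notin> B"
    and occ: "\<And>i. 0 < i \<Longrightarrow> i < j \<Longrightarrow> f i \<in> B" and i: "0 < i" "i < j"
  shows "energy (insert (f 0) (B - {f i})) \<le> energy B + U * (if Suc i = j then 1 else 2)"
proof -
  have finB: "finite B" using B finite_subset_hexagon by auto
  define d where "d = deg (B - {f i}) (f i)"
  define g where "g = deg (B - {f i}) (f 0)"
  have B_eq: "insert (f i) (B - {f i}) = B" using occ[OF i] by auto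
  have Bi: "(B - {f i}) \<inter> hexagon L = B - {f i}" using B by auto
  have "energy B = energy (B - {f i}) + \<Delta> - U * real d"
    using energy_insert_hexagon[of "B - {f i}" "f i"] finB B occ[OF i] unfolding B_eq d_def Bi by auto
  moreover have "energy (insert (f 0) (B - {f i})) = energy (B - {f i}) + \<Delta> - U * real g"
    using energy_insert_hexagon[of "B - {f i}" "f 0"] finB f(2) unfolding g_def Bi by simp
  ultimately have E: "energy (insert (f 0) (B - {f i})) = energy B + U * (real d - real g)"
    by (simp add: algebra_simps)
  let ?X = "(if i = 1 then {f 0} else {}) \<union> (if Suc i = j then {f j} else {})"
  have "card ?X = (if i = 1 then 1 else 0) + (if Suc i = j then 1 else 0)"
    using walkD(1)[OF f(1)] i by auto
  moreover have "?X \<subseteq> nbrs (f i) - (B - {f i})"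
    using walkD[OF f(1)] i f(2,3) by (auto split: if_splits)
  then have "card ?X \<le> card (nbrs (f i) - (B - {f i}))" by (intro card_mono) auto
  moreover have "d + card (nbrs (f i) - (B - {f i})) = 3"
    using card_Int_Diff[of "nbrs (f i)" "B - {f i}"] by (simp add: d_def deg_def)
  ultimately have d: "d + (if i = 1 then 1 else 0) + (if Suc i = j then 1 else 0) \<le> 3" by linarith
  have "g \<ge> 1" if "i \<noteq> 1"
  proof -
    have "f 1 \<in> nbrs (f 0) \<inter> (B - {f i})"
      using walkD(2)[OF f(1), of 0] walkD(1)[OF f(1)] occ[of 1] i that by auto
    then have "nbrs (f 0) \<inter> (B - {f i}) \<noteq> {}" by blast
    then show ?thesis by (simp add: g_def deg_def Suc_le_eq card_gt_0_iff)
  qed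
  with d have "real d - real g \<le> (if Suc i = j then 1 else 2)" by (auto split: if_splits)
  then have "U * (real d - real g) \<le> U * (if Suc i = j then 1 else 2)" using U_pos by (intro mult_left_mono) auto
  then show ?thesis using E by simp
qed

text \<open>
  Let \<open>f j\<close> be the first vacancy on the walk from \<open>f 0\<close> to the exit. If it lies in the hexagon, fill it
  recursively and let a hole wander from \<open>f 0\<close> to \<open>f j\<close>. Otherwise the hole wanders first and the
  particle enters afterwards, since it has no bonds while it waits outside the hexagon.
\<close>

lemma transport_aux:
  assumes B: "B \<subseteq> hexagon L"
  shows "walk f \<Longrightarrow> (\<And>i. i < k \<Longrightarrow> f i \<in> hexagon L) \<Longrightarrow> f k \<in> Box_bd L \<Longrightarrow> 0 < k \<Longrightarrow> f 0 \<notin> B \<Longrightarrow>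
    reach (energy B + \<Delta> + U) B (insert (f 0) B)"
proof (induction k arbitrary: f rule: less_induct)
  case (less k)
  note f = less.prems
  let ?h = "energy B + \<Delta> + U"
  have BBox: "B \<subseteq> Box L" using B hexagon_subset_Box by auto
  have finB: "finite B" using B finite_subset_hexagon by auto
  have in_Box: "f i \<in> Box L" if "i \<le> k" for i
    using that f hexagon_subset_Box[of L] Box_bd_subset[of L] by (cases "i = k") auto
  note wd = walkD[OF f(1)]
  define j where "j = (LEAST j. 0 < j \<and> f j \<notin> B)"
  have fk: "0 < k \<and> f k \<notin> B" using f B by (auto simp: Box_bd_eq)
  then have j: "0 < j" "f j \<notin> B" using LeastI[of "\<lambda>j. 0 < j \<and> f j \<notin> B" k] by (auto simp: j_def)
  have jk: "j \<le> k" unfolding j_def using fk by (rule Least_le)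
  have occ: "f i \<in> B" if "0 < i" "i < j" for i using not_less_Least[of i] that unfolding j_def by auto
  have f0: "f 0 \<in> hexagon L - B" using f by auto
  have hole: "energy (insert (f 0) (B - {f i})) \<le> energy B + U * (if Suc i = j then 1 else 2)"
    if "0 < i" "i < j" for i using energy_hole[OF B f(1) f0 j(2) occ that] .
  show ?case
  proof (cases "j < k")
    case True
    have "reach ?h B (insert (f (0 + j)) B)"
      using f True j by (intro less.IH[of "k - j"] walk_shift) auto
    moreover have "reach ?h (insert (f j) (insert (f 0) B) - {f 0}) (insert (f j) (insert (f 0) B) - {f j})"
    proof (rule reach_seq[where T = "\<lambda>i. insert (f j) (insert (f 0) B) - {f i}"])
      fix i assume i: "i < j"
      show "moves L (insert (f j) (insert (f 0) B) - {f i}) (insert (f j) (insert (f 0) B) - {f (Suc i)})"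
      proof (rule movesI[of "f (Suc i)" "f i"])
        show "f (Suc i) \<in> insert (f j) (insert (f 0) B) - {f i}"
          using i occ[of "Suc i"] wd(1) by (cases "Suc i = j") auto
        have "f i \<in> insert (f j) (insert (f 0) B)" using i occ[of i] by (cases "i = 0") auto
        then show "insert (f j) (insert (f 0) B) - {f (Suc i)} =
            insert (f i) (insert (f j) (insert (f 0) B) - {f i} - {f (Suc i)})"
          using wd(1)[of i "Suc i"] by auto
      qed (use i jk in_Box wd in auto)
    next
      fix i assume i: "i \<le> j"
      have "energy (insert (f j) (insert (f 0) B) - {f i}) \<le> ?h"
      proof -
        consider "i = 0" | "i = j" | "0 < i" "i < j" using i by linarith
        then show ?thesis
        proof cases
          case 1
          then have "insert (f j) (insert (f 0) B) - {f i} = insert (f j) B" using f0 wd(1) j by auto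
          then show ?thesis using energy_insert_le[OF finB, of "f j"] U_pos by simp
        next
          case 2
          then have "insert (f j) (insert (f 0) B) - {f i} = insert (f 0) B" using j wd(1) by auto
          then show ?thesis using energy_insert_le[OF finB, of "f 0"] U_pos by simp
        next
          case 3
          let ?B = "insert (f 0) (B - {f i})"
          have eq: "insert (f j) (insert (f 0) B) - {f i} = insert (f j) ?B" using wd(1) 3 by auto
          have new: "f j \<notin> ?B" using j wd(1) by auto
          have *: "energy (insert (f j) ?B) = energy ?B + \<Delta> - U * real (deg (?B \<inter> hexagon L) (f j))"
            using f True new finB by (intro energy_insert_hexagon) auto
          show ?thesis
          proof (cases "Suc i = j")
            case True
            have "0 \<le> U * real (deg (?B \<inter> hexagon L) (f j))" using U_pos by simp
            then show ?thesis unfolding eq * using hole[OF 3] True by simp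
          next
            case False
            \<comment> \<open>While the hole is away from \<open>f (j - 1)\<close>, the added
              particle at \<open>f j\<close> is bound to \<open>f (j - 1)\<close>; this bond pays
              for the second U in \<open>hole\<close>.\<close>
            have "f (j - 1) \<in> B" using occ[of "j - 1"] 3 by auto
            moreover have "f (j - 1) \<noteq> f i" using wd(1) 3 False by auto
            moreover have "f (j - 1) \<in> nbrs (f j)" using wd(3)[of "j - 1"] j by simp
            ultimately have "f (j - 1) \<in> nbrs (f j) \<inter> (?B \<inter> hexagon L)" using B by auto
            then have "nbrs (f j) \<inter> (?B \<inter> hexagon L) \<noteq> {}" by blast
            then have "1 \<le> deg (?B \<inter> hexagon L) (f j)" by (simp add: deg_def Suc_le_eq card_gt_0_iff)
            then have "U * 1 \<le> U * real (deg (?B \<inter> hexagon L) (f j))" using U_pos by (intro mult_left_mono) auto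
            then show ?thesis unfolding eq * using hole[OF 3] False by simp
          qed
        qed
      qed
      moreover have "f j \<in> Box L" "f 0 \<in> Box L" using in_Box jk by auto
      ultimately show "insert (f j) (insert (f 0) B) - {f i} \<subseteq> Box L \<and>
          energy (insert (f j) (insert (f 0) B) - {f i}) \<le> ?h" using BBox by auto
    qed
    moreover have "insert (f j) (insert (f 0) B) - {f 0} = insert (f j) B" using f0 wd(1) j by auto
    moreover have "insert (f j) (insert (f 0) B) - {f j} = insert (f 0) B" using j wd(1) by auto
    ultimately show ?thesis using reach_trans by simp
  next
    case False
    then have jk: "j = k" using jk by simp
    let ?T = "\<lambda>i. insert (f 0) B - {f i}"
    have T_eq: "?T i = insert (f 0) (B - {f i})" if "0 < i" for i using wd(1) that by auto
    have T0: "?T 0 = B" using f0 by auto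
    have ET: "energy (?T i) \<le> energy B + U * (if Suc i = k then 1 else 2)" if "i < k" for i
    proof (cases "i = 0")
      case True
      then show ?thesis unfolding True T0 using U_pos by simp
    next
      case False
      then have "0 < i" by simp
      then show ?thesis unfolding T_eq[OF \<open>0 < i\<close>] using hole[of i] that jk by auto
    qed
    have TBox: "?T i \<subseteq> Box L" for i using BBox in_Box by auto
    have "reach ?h (?T 0) (?T (k - 1))"
    proof (rule reach_seq[where T = ?T])
      fix i assume i: "i < k - 1"
      show "moves L (?T i) (?T (Suc i))"
      proof (rule movesI[of "f (Suc i)" "f i"])
        show "f (Suc i) \<in> ?T i" using i occ[of "Suc i"] wd(1) jk by auto
        have "f i \<in> insert (f 0) B" using i occ[of i] jk by (cases "i = 0") auto
        then show "?T (Suc i) = insert (f i) (?T i - {f (Suc i)})"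
          using wd(1)[of i "Suc i"] by auto
      qed (use i in_Box wd in auto)
    next
      fix i assume "i \<le> k - 1"
      then have "i < k" using f by auto
      then have "energy (?T i) \<le> energy B + U * 2"
        using ET[of i] U_pos by (auto split: if_splits)
      then show "?T i \<subseteq> Box L \<and> energy (?T i) \<le> ?h" using TBox U_less_\<Delta> by auto
    qed
    \<comment> \<open>The creation waits until the hole sits next to the exit, where its cost is
      only U instead of 2 U.\<close>
    moreover have "reach ?h (?T (k - 1)) (insert (f k) (?T (k - 1)))"
      using ET[of "k - 1"] f fk TBox wd(1) by (intro reach_create) auto
    moreover have "reach ?h (insert (f k) (?T (k - 1))) (insert (f 0) B)"
    proof (rule reach_step)
      have "f (k - 1) \<in> insert (f 0) B" using occ[of "k - 1"] f(4) jk by (cases "k = 1") auto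
      then show "moves L (insert (f k) (?T (k - 1))) (insert (f 0) B)"
        using f fk wd(1) wd(3)[of "k - 1"] in_Box
        by (intro movesI[of "f k" "f (k - 1)"]) auto
      show "insert (f k) (?T (k - 1)) \<subseteq> Box L" using TBox in_Box[of k] by auto
      show "energy (insert (f k) (?T (k - 1))) \<le> ?h"
        using energy_insert_le[of "?T (k - 1)" "f k"] finB ET[of "k - 1"] f by auto
      show "energy (insert (f 0) B) \<le> ?h" using energy_insert_le[OF finB, of "f 0"] U_pos by simp
    qed
    ultimately show ?thesis using reach_trans unfolding T0 by blast
  qed
qed

lemma transport:
  assumes "B \<subseteq> hexagon L" "x \<in> hexagon L" "x \<notin> B"
  shows "reach (energy B + \<Delta> + U) B (insert x B)"
proof -
  obtain f where f: "walk f" "f 0 = x" using exists_walk by blast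
  obtain k where "k > 0" "\<And>i. i < k \<Longrightarrow> f i \<in> hexagon L" "f k \<in> Box_bd L"
    using walk_exit[OF f(1)] f(2) assms(2) by blast
  then show ?thesis using transport_aux[OF assms(1) f(1)] f(2) assms(3) by blast
qed

end

subsection \<open>Comparison of the barriers of all bars\<close>

lemma bars_total_eq:
  assumes "R \<ge> 1" "i < 6"
  shows "int (bars_total R i) = 2 * int i * int R + [0, -1, 0, 1, 2, 3] ! i"
proof -
  have "\<forall>i<6. int (bars_total R i) = 2 * int i * int R + [0, -1, 0, 1, 2, 3] ! i"
    unfolding all_less_6 using assms(1) by (simp add: bars_total_def bar_length_def numeral_eq_Suc)
  then show ?thesis using assms(2) by blast
qed

lemma consecutive_product_nonneg: "0 \<le> (d::int) * (d + 1)"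
  by (cases "0 \<le> d") (auto simp: zero_le_mult_iff)

lemma interpolate_nonneg:
  fixes x y \<delta> :: real
  assumes "a \<le> \<delta>" "\<delta> \<le> b" "0 \<le> x + a * y" "0 \<le> x + b * y"
  shows "0 \<le> x + \<delta> * y"
proof (cases "0 \<le> y")
  case True
  then have "a * y \<le> \<delta> * y" using assms by (intro mult_right_mono) auto
  then show ?thesis using assms by linarith
next
  case False
  then have "b * y \<le> \<delta> * y" using assms by (intro mult_right_mono_neg) auto
  then show ?thesis using assms by linarith
qed

text \<open>
  Here \<open>\<rho>\<close> is the critical radius, \<open>2 \<rho> + 1 + 2 \<delta>\<close> is the ratio \<open>U / \<epsilon>\<close>, and energies are divided
  by \<open>\<epsilon> / 2\<close>. Both bounds are affine in \<open>\<delta>\<close>, so it suffices to check the ends of the range of \<open>\<delta>\<close>,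
  where they are quadratic inequalities for the integer \<open>\<rho> - R\<close>.
\<close>

lemma barrier_arith:
  fixes R \<rho> :: int and \<delta> :: real
  assumes i: "i < 6"
  defines "lhs \<equiv> (2 * real_of_int \<rho> + 1 + 2 * \<delta>) * (6 * real_of_int R + real i + 2)
    - (6 * real_of_int R^2 + (2 * real i * real_of_int R + real_of_int ([0, -1, 0, 1, 2, 3] ! i)) + 2)"
  shows "0 \<le> \<delta> \<Longrightarrow> \<delta> \<le> 1 / 2 \<Longrightarrow>
      lhs \<le> (2 * real_of_int \<rho> + 1 + 2 * \<delta>) * (6 * real_of_int \<rho> + 7) - (6 * real_of_int \<rho>^2 + 10 * real_of_int \<rho> + 5)"
    and "1 / 2 \<le> \<delta> \<Longrightarrow> \<delta> \<le> 1 \<Longrightarrow>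
      lhs \<le> (2 * real_of_int \<rho> + 1 + 2 * \<delta>) * (6 * real_of_int \<rho> + 9) - (6 * real_of_int \<rho>^2 + 14 * real_of_int \<rho> + 9)"
proof -
  define d where "d = \<rho> - R"
  have R: "R = \<rho> - d" by (simp add: d_def)
  \<comment> \<open>The gaps between the claimed bounds and \<open>lhs\<close> are
    \<open>e0\<close>, \<open>e0 + e1\<close> and \<open>e0 + 2 * e1 + 2\<close> at \<delta> = 0,
    1/2, 1; at 1/2 both bounds agree.\<close>
  define e0 where "e0 = 6 * (d * d) + (6 - 2 * int i) * d + (2 - int i) + [0, -1, 0, 1, 2, 3] ! i"
  define e1 where "e1 = 6 * d + 5 - int i"
  have cases: "i \<in> {0, 1, 2, 3, 4, 5}" using i by auto
  \<comment> \<open>Integrality of \<open>d\<close> is essential: some of these quadratics are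
    negative for real \<open>d\<close> between consecutive integers. Products of consecutive
    integers express this.\<close>
  have int: "0 \<le> e0" "0 \<le> e0 + e1" "0 \<le> e0 + 2 * e1 + 2"
    using cases consecutive_product_nonneg[of d] consecutive_product_nonneg[of "d + 1"]
      consecutive_product_nonneg[of "d - 1"] zero_le_square[of d] zero_le_square[of "d + 1"]
    unfolding e0_def e1_def by (auto simp: algebra_simps)
  have real: "0 \<le> real_of_int e0" "0 \<le> real_of_int e0 + real_of_int e1" "0 \<le> real_of_int e0 + 2 * real_of_int e1 + 2"
    using int by linarith+
  have eq1: "(2 * real_of_int \<rho> + 1 + 2 * \<delta>) * (6 * real_of_int \<rho> + 7) - (6 * real_of_int \<rho>^2 + 10 * real_of_int \<rho> + 5) - lhs
      = real_of_int e0 + \<delta> * (2 * real_of_int e1)"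
    unfolding lhs_def e0_def e1_def R by (simp add: algebra_simps power2_eq_square)
  have eq2: "(2 * real_of_int \<rho> + 1 + 2 * \<delta>) * (6 * real_of_int \<rho> + 9) - (6 * real_of_int \<rho>^2 + 14 * real_of_int \<rho> + 9) - lhs
      = (real_of_int e0 - 2) + \<delta> * (2 * real_of_int e1 + 4)"
    unfolding lhs_def e0_def e1_def R by (simp add: algebra_simps power2_eq_square)
  show "lhs \<le> (2 * real_of_int \<rho> + 1 + 2 * \<delta>) * (6 * real_of_int \<rho> + 7) - (6 * real_of_int \<rho>^2 + 10 * real_of_int \<rho> + 5)"
    if "0 \<le> \<delta>" "\<delta> \<le> 1 / 2"
    using interpolate_nonneg[OF that, of "real_of_int e0" "2 * real_of_int e1"] real eq1 by simp
  show "lhs \<le> (2 * real_of_int \<rho> + 1 + 2 * \<delta>) * (6 * real_of_int \<rho> + 9) - (6 * real_of_int \<rho>^2 + 14 * real_of_int \<rho> + 9)"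
    if "1 / 2 \<le> \<delta>" "\<delta> \<le> 1"
  proof -
    have "0 \<le> (real_of_int e0 - 2) + \<delta> * (2 * real_of_int e1 + 4)"
      by (rule interpolate_nonneg[OF that]) (use real in \<open>simp_all add: field_simps\<close>)
    then show ?thesis using eq2 by linarith
  qed
qed

context lattice_gas
begin

subsection \<open>Attaching sets of particles\<close>

text \<open>A crude estimate that ignores all new bonds; it is accurate enough for the six faces of
  the initial hexagon.\<close>

lemma reach_add_set:
  assumes "finite A" "A \<subseteq> hexagon L" "S \<subseteq> hexagon L" "energy S + \<Delta> * real (card A) + \<Delta> + U \<le> h"
  shows "reach h S (S \<union> A)"
  using assms(1,2,4)
proof (induction arbitrary: h)
  case (insert x A)
  have \<Delta>: "0 < \<Delta>" using U_pos U_less_\<Delta> by simp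
  have le: "energy S + \<Delta> * real (card A) + \<Delta> + U \<le> h"
    using insert.prems insert.hyps \<Delta> by (simp add: algebra_simps)
  then have "reach h S (S \<union> A)" using insert by auto
  moreover have "reach h (S \<union> A) (insert x (S \<union> A))"
  proof (cases "x \<in> S \<union> A")
    case True
    then show ?thesis by (simp add: insert_absorb)
  next
    case False
    have "energy (S \<union> A) \<le> energy S + \<Delta> * real (card A)"
      using energy_Un_le insert.hyps finite_subset_hexagon[OF assms(3)] by blast
    then have "energy (S \<union> A) + \<Delta> + U \<le> h" using le by linarith
    moreover have "reach (energy (S \<union> A) + \<Delta> + U) (S \<union> A) (insert x (S \<union> A))"
      using False insert.prems assms(3) by (intro transport) auto
    ultimately show ?thesis using reach_mono by blast
  qed
  ultimately show ?case using reach_trans by simp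
qed simp

lemma reach_bar:
  assumes f: "alongside K m f" and sub: "K \<union> f ` {..<m} \<subseteq> hexagon L"
    and h: "\<And>j. j < m \<Longrightarrow> energy (K \<union> f ` {..<j}) + \<Delta> \<le> h"
  shows "reach h K (K \<union> f ` {..<m})"
proof -
  have "reach h K (K \<union> f ` {..<j})" if "j \<le> m" for j
    using that
  proof (induction j)
    case (Suc j)
    let ?A = "K \<union> f ` {..<j}"
    have w: "walk f" and disj: "range f \<inter> K = {}" using f by (auto simp: alongside_def)
    have "reach (energy ?A + \<Delta>) ?A (insert (f (0 + j)) ?A)"
    proof (rule transport_free)
      show "range (\<lambda>i. f (i + j)) \<inter> ?A = {}" using disj walkD(1)[OF w] by auto
      show "?A \<subseteq> hexagon L" "f (0 + j) \<in> hexagon L" using sub Suc.prems by auto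
    qed (rule walk_shift[OF w])
    then have "reach h ?A (K \<union> f ` {..<Suc j})"
      using h[of j] Suc.prems reach_mono by (auto simp: lessThan_Suc)
    then show ?case using Suc reach_trans by auto
  qed simp
  then show ?thesis by simp
qed

text \<open>Faces already in \<open>S\<close> are skipped, and since \<open>S\<close> may block the
  escape route along the strip, each arrival is charged \<Delta> + U instead of \<Delta>.\<close>

lemma reach_bar_Un:
  fixes f :: "nat \<Rightarrow> site"
  assumes S: "S \<subseteq> hexagon L" and sub: "K \<union> f ` {..<m} \<subseteq> hexagon L"
    and h: "\<And>j. j < m \<Longrightarrow> energy (S \<union> (K \<union> f ` {..<j})) + \<Delta> + U \<le> h"
  shows "reach h (S \<union> K) (S \<union> (K \<union> f ` {..<m}))"
proof -
  have "reach h (S \<union> K) (S \<union> (K \<union> f ` {..<j}))" if "j \<le> m" for j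
    using that
  proof (induction j)
    case (Suc j)
    let ?A = "S \<union> (K \<union> f ` {..<j})"
    have eq: "S \<union> (K \<union> f ` {..<Suc j}) = insert (f j) ?A" by (auto simp: lessThan_Suc)
    have "reach h ?A (insert (f j) ?A)"
    proof (cases "f j \<in> ?A")
      case True
      then show ?thesis by (simp only: insert_absorb reach_refl)
    next
      case False
      have "reach (energy ?A + \<Delta> + U) ?A (insert (f j) ?A)"
        using False S sub Suc.prems by (intro transport) auto
      then show ?thesis using h[of j] Suc.prems reach_mono by auto
    qed
    then show ?case using Suc reach_trans unfolding eq by auto
  qed simp
  then show ?thesis by simp
qed

text \<open>It supplies the nonempty sets of paths required for lower bounds on communication
  heights.\<close>

lemma exists_reach:
  assumes "S \<subseteq> Box L"
  shows "\<exists>h. reach h {} S"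
proof -
  have \<Delta>: "0 < \<Delta>" using U_pos U_less_\<Delta> by simp
  define h0 where "h0 = \<Delta> * real (card (S \<inter> hexagon L)) + \<Delta> + U"
  have 1: "reach h0 {} (S \<inter> hexagon L)"
    using finite_subset_Box[OF assms] reach_add_set[of "S \<inter> hexagon L" "{}" h0] by (auto simp: h0_def)
  have "finite D \<Longrightarrow> D \<subseteq> Box_bd L \<Longrightarrow> \<exists>h. reach h (S \<inter> hexagon L) (S \<inter> hexagon L \<union> D)" for D
  proof (induction rule: finite_induct)
    case empty
    then show ?case by auto
  next
    case (insert x D)
    let ?S = "S \<inter> hexagon L \<union> D"
    obtain h where h: "reach h (S \<inter> hexagon L) ?S" using insert by auto
    have "reach (energy ?S + \<Delta>) ?S (insert x ?S)"
      using insert assms Box_bd_subset[of L] by (intro reach_create) (auto simp: Box_bd_eq)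
    then have "reach (max h (energy ?S + \<Delta>)) (S \<inter> hexagon L) (insert x ?S)"
      using reach_trans[OF reach_mono[OF max.cobounded1 h] reach_mono[OF max.cobounded2]] by blast
    then show ?case by auto
  qed
  moreover have "finite (S - hexagon L)" "S - hexagon L \<subseteq> Box_bd L"
    using finite_subset_Box[OF assms] assms by (auto simp: Box_bd_eq)
  ultimately obtain h where h: "reach h (S \<inter> hexagon L) (S \<inter> hexagon L \<union> (S - hexagon L))" by blast
  have S_eq: "S \<inter> hexagon L \<union> (S - hexagon L) = S" by auto
  have "reach (max h0 h) {} S"
    using reach_trans[OF reach_mono[OF max.cobounded1 1] reach_mono[OF max.cobounded2 h]] unfolding S_eq .
  then show ?thesis by blast
qed

subsection \<open>Lower bounds on the energy\<close>

text \<open>A particle outside the hexagon counts like an isolated face, which has perimeter three.\<close>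

lemma energy_isoperimetric:
  assumes S: "S \<subseteq> Box L"
  obtains P :: int where "0 \<le> P" "energy S = U / 2 * of_int P - \<epsilon> / 2 * real (card S)"
    "6 * int (card S) \<le> P^2" "even P \<longleftrightarrow> even (card S)"
proof -
  let ?C = "S \<inter> hexagon L"
  define k where "k = card (S - hexagon L)"
  define P where "P = int (per ?C) + 3 * int k"
  have fin: "finite S" using finite_subset_Box[OF S] .
  have card: "card S = card ?C + k" using card_Int_Diff[OF fin, of "hexagon L"] by (simp add: k_def)
  have "energy S = energy ?C + \<Delta> * real k" by (simp add: energy_def card algebra_simps)
  also have "energy ?C = U / 2 * real (per ?C) - \<epsilon> / 2 * real (card ?C)" by (intro energy_per) auto
  finally have "energy S = U / 2 * of_int P - \<epsilon> / 2 * real (card S)"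
    by (simp add: P_def card \<epsilon>_def field_simps)
  moreover have "6 * int (card S) \<le> P^2"
  proof -
    have "6 * int (card ?C) \<le> int (per ?C)^2" using fin by (intro isoperimetric) auto
    moreover have "6 * int k \<le> 9 * (int k * int k)"
    proof -
      have "int k * 1 \<le> int k * int k" by (cases "k = 0") (auto intro!: mult_left_mono)
      then show ?thesis by linarith
    qed
    moreover have "P^2 = int (per ?C)^2 + 9 * (int k * int k) + 6 * (int (per ?C) * int k)"
      unfolding P_def by (simp add: power2_eq_square algebra_simps)
    moreover have "0 \<le> int (per ?C) * int k" by simp
    moreover have "6 * a \<le> x \<Longrightarrow> 6 * b \<le> 9 * y \<Longrightarrow> q = x + 9 * y + 6 * z \<Longrightarrow> 0 \<le> z \<Longrightarrow> 6 * (a + b) \<le> q"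
      for a b x y z q :: int by (simp add: distrib_left)
    ultimately show ?thesis unfolding card of_nat_add by blast
  qed
  moreover have "even P \<longleftrightarrow> even (card S)"
    using even_per[of ?C] fin by (simp add: P_def card)
  ultimately show thesis using that[of P] by (auto simp: P_def)
qed

end

section \<open>The critical cluster and the value of the barrier\<close>

locale critical_gas = lattice_gas L U \<Delta> for L :: nat and U \<Delta> :: real +
  assumes small: "3 * U - 2 * \<Delta> \<le> U / 100"
    and ratio: "crit_ratio U \<Delta> \<notin> \<int>"
    and half: "crit_frac U \<Delta> \<noteq> 1 / 2"
    and large: "int L > 2 * crit_radius U \<Delta> + 3"
begin

definition \<rho> :: int where "\<rho> = crit_radius U \<Delta>"
definition \<delta> :: real where "\<delta> = crit_frac U \<Delta>"
definition u :: real where "u = 2 * real_of_int \<rho> + 1 + 2 * \<delta>"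
text \<open>Perimeter and size of the critical cluster: two faces attached to the hexagon of radius
  \<rho> with five bars, or to the hexagon of radius \<rho> + 1 with one bar.\<close>

definition crit_per :: int where "crit_per = (if \<delta> < 1 / 2 then 6 * \<rho> + 7 else 6 * \<rho> + 9)"
definition crit_card :: int where
  "crit_card = (if \<delta> < 1 / 2 then 6 * \<rho>^2 + 10 * \<rho> + 5 else 6 * \<rho>^2 + 14 * \<rho> + 9)"

abbreviation "\<Gamma> \<equiv> Gamma_KHex U \<Delta>"

lemma \<epsilon>_le: "\<epsilon> \<le> U / 100"
  using small by (simp add: \<epsilon>_def)

lemma \<delta>_bounds: "0 < \<delta>" "\<delta> < 1"
proof -
  show "0 < \<delta>" using ratio frac_ge_0[of "crit_ratio U \<Delta>"] frac_eq_0_iff[of "crit_ratio U \<Delta>"]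
    unfolding \<delta>_def crit_frac_def by linarith
  show "\<delta> < 1" unfolding \<delta>_def crit_frac_def by (rule frac_lt_1)
qed

lemma ratio_eq: "U / (2 * \<epsilon>) - 1 / 2 = real_of_int \<rho> + \<delta>"
  by (simp add: \<rho>_def \<delta>_def crit_radius_def crit_frac_def frac_def crit_ratio_def \<epsilon>_def)

lemma U_eq: "U = \<epsilon> * u"
proof -
  have "U / (2 * \<epsilon>) = u / 2" using ratio_eq by (simp add: u_def field_simps)
  then show ?thesis using \<epsilon>_pos by (simp add: field_simps)
qed

lemma half_U: "U / 2 * x = \<epsilon> / 2 * (u * x)"
  using U_eq by (metis mult.assoc times_divide_eq_left)

lemma u_ge: "100 \<le> u"
proof -
  have "\<epsilon> * 100 \<le> \<epsilon> * u" using \<epsilon>_le unfolding U_eq[symmetric] by simp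
  then show ?thesis using \<epsilon>_pos by simp
qed

lemma \<rho>_ge: "49 \<le> \<rho>"
proof -
  have "48 < real_of_int \<rho>" using u_ge \<delta>_bounds unfolding u_def by linarith
  then show ?thesis by linarith
qed

text \<open>The ratio \<open>u\<close> = U / \<epsilon> is the radius at which \<epsilon> / 2 * (6 u
  R - 6 R^2), the energy of a hexagon of radius R and perimeter 6 R, returns to zero.\<close>

lemma u_less_L: "u < real L"
proof -
  have "2 * \<rho> + 4 \<le> int L" using large by (simp add: \<rho>_def)
  then have "real_of_int (2 * \<rho> + 4) \<le> real_of_int (int L)" by (simp only: of_int_le_iff)
  then show ?thesis using \<delta>_bounds by (simp add: u_def)
qed

lemma L_pos: "1 \<le> L"
  using u_less_L u_ge by linarith

lemma energy_u:
  assumes "S \<subseteq> hexagon L"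
  shows "energy S = \<epsilon> / 2 * (u * real (per S) - real (card S))"
  unfolding energy_per[OF assms] half_U right_diff_distrib ..

lemma Gamma_eq: "\<Gamma> = U / 2 * of_int crit_per - \<epsilon> / 2 * of_int crit_card + \<Delta>"
  unfolding Gamma_KHex_def Gamma1_def Gamma2_def Let_def crit_per_def crit_card_def
    \<delta>_def[symmetric] \<rho>_def[symmetric] \<epsilon>_def
  by (simp add: power2_eq_square field_simps)

text \<open>The left side belongs to the hexagon of radius \<open>R\<close> with \<open>i\<close>
  complete bars, two faces of the next one, and a further particle in transit.\<close>

lemma barrier_le:
  assumes "R \<ge> 1" "i < 6"
  shows "U / 2 * (6 * real R + real i + 2) - \<epsilon> / 2 * (6 * (real R)^2 + real (bars_total R i) + 2) + \<Delta> \<le> \<Gamma>"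
proof -
  have "real (bars_total R i) = real_of_int (int (bars_total R i))" by simp
  also have "\<dots> = 2 * real i * real R + real_of_int ([0, -1, 0, 1, 2, 3] ! i)"
    unfolding bars_total_eq[OF assms] by simp
  finally have b: "real (bars_total R i) = 2 * real i * real R + real_of_int ([0, -1, 0, 1, 2, 3] ! i)" .
  have "u * (6 * real R + real i + 2) - (6 * (real R)^2 + real (bars_total R i) + 2)
      \<le> u * of_int crit_per - of_int crit_card"
  proof (cases "\<delta> < 1 / 2")
    case True
    then show ?thesis using barrier_arith(1)[OF assms(2), of \<delta> \<rho> "int R"] \<delta>_bounds
      unfolding b u_def crit_per_def crit_card_def by simp
  next
    case False
    then show ?thesis using barrier_arith(2)[OF assms(2), of \<delta> \<rho> "int R"] \<delta>_bounds
      unfolding b u_def crit_per_def crit_card_def by simp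
  qed
  then have "\<epsilon> / 2 * (u * (6 * real R + real i + 2) - (6 * (real R)^2 + real (bars_total R i) + 2))
      \<le> \<epsilon> / 2 * (u * of_int crit_per - of_int crit_card)"
    using \<epsilon>_pos by (intro mult_left_mono) auto
  then show ?thesis unfolding Gamma_eq half_U right_diff_distrib by linarith
qed

text \<open>Radius 10 without bars already gives 31 U - 301 \<epsilon> + \<Delta>, and \<epsilon> is
  at most U / 100.\<close>

lemma Gamma_ge: "20 * U \<le> \<Gamma>"
  using barrier_le[of 10 0] \<epsilon>_le U_pos U_less_\<Delta> by (simp add: bars_total_def power2_eq_square)

lemma crit_card_pos: "0 < crit_card"
  using \<rho>_ge by (auto simp: crit_card_def intro!: add_nonneg_pos add_nonneg_nonneg)

text \<open>Since \<open>(crit_per - 2)^2 < 6 * crit_card\<close>, the effective perimeter exceeds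
  \<open>crit_per - 2\<close>; both are odd, so it is at least \<open>crit_per\<close>.\<close>

lemma energy_ge_at_crit_card:
  assumes "S \<subseteq> Box L" "int (card S) = crit_card"
  shows "\<Gamma> - \<Delta> \<le> energy S"
proof -
  obtain P :: int where P: "0 \<le> P" "energy S = U / 2 * of_int P - \<epsilon> / 2 * real (card S)"
    "6 * int (card S) \<le> P^2" "even P \<longleftrightarrow> even (card S)"
    using energy_isoperimetric[OF assms(1)] by blast
  have "(crit_per - 2)^2 < 6 * crit_card"
    by (simp add: crit_per_def crit_card_def power2_eq_square algebra_simps)
  then have "(crit_per - 2)^2 < P^2" using P(3) assms(2) by simp
  then have "crit_per - 2 < P" using P(1) by (rule power2_less_imp_less)
  moreover have "odd (int (card S))" unfolding assms(2) crit_card_def by auto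
  then have "odd P" using P(4) by simp
  moreover have "odd crit_per" by (auto simp: crit_per_def)
  ultimately have "crit_per \<le> P" by presburger
  then have "U / 2 * of_int crit_per \<le> U / 2 * of_int P" using U_pos by (intro mult_left_mono) auto
  moreover have "real (card S) = real_of_int crit_card" using assms(2) by (metis of_int_of_nat_eq)
  ultimately show ?thesis unfolding Gamma_eq P(2) by simp
qed

text \<open>With \<open>n\<close> particles, \<open>n \<le> 6 * u^2\<close> and
  \<open>6 * n \<le> P^2\<close> multiply to \<open>n \<le> u * P\<close>, which is nonnegativity of
  the energy. Hence every path from the empty configuration to a lower energy crosses the critical
  number.\<close>

lemma energy_nonneg_upto_crit_card:
  assumes "S \<subseteq> Box L" "int (card S) \<le> crit_card"
  shows "0 \<le> energy S"
proof -
  obtain P :: int where P: "0 \<le> P" "energy S = U / 2 * of_int P - \<epsilon> / 2 * real (card S)"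
    "6 * int (card S) \<le> P^2"
    using energy_isoperimetric[OF assms(1)] by blast
  define n where "n = real (card S)"
  have "crit_card \<le> 6 * (2 * \<rho> + 1)^2"
    using \<rho>_ge mult_mono[of 1 \<rho> 1 \<rho>] by (simp add: crit_card_def power2_eq_square algebra_simps)
  then have "real_of_int (int (card S)) \<le> real_of_int (6 * (2 * \<rho> + 1)^2)"
    using assms(2) by (simp only: of_int_le_iff)
  then have "n \<le> 6 * (2 * real_of_int \<rho> + 1)^2" by (simp add: n_def)
  also have "(2 * real_of_int \<rho> + 1)^2 \<le> u^2"
    using \<delta>_bounds \<rho>_ge by (intro power_mono) (simp_all add: u_def)
  finally have "n * n \<le> 6 * u^2 * n" by (intro mult_right_mono) (simp_all add: n_def)
  moreover have "real_of_int (6 * int (card S)) \<le> real_of_int (P^2)" using P(3) by (simp only: of_int_le_iff)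
  then have "u^2 * (6 * n) \<le> u^2 * (real_of_int P)^2" by (intro mult_left_mono) (simp_all add: n_def)
  ultimately have "n^2 \<le> (u * real_of_int P)^2"
    unfolding power_mult_distrib power2_eq_square[of n] by (simp only: mult.assoc mult.left_commute[of 6])
  then have "n \<le> u * real_of_int P"
    by (rule power2_le_imp_le) (use u_ge P(1) in auto)
  then have "0 \<le> \<epsilon> / 2 * (u * real_of_int P - n)" using \<epsilon>_pos by simp
  then show ?thesis unfolding P(2) half_U n_def right_diff_distrib .
qed

section \<open>The full hexagon as the only ground state\<close>

lemma grows_hexagon: "x \<in> hexagon L \<Longrightarrow> grows x L (hexagon L)"
  unfolding hexagon_eq_Hex using L_pos by (rule grows_Hex)

lemma hexagon_not_empty: "Up 0 0 \<in> hexagon L"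
  using L_pos by (simp add: hexagon_eq_Hex Hex_def region_def)

lemma card_hexagon: "card (hexagon L) = 6 * L^2" and per_hexagon: "per (hexagon L) \<le> 6 * L"
  using grows_props[OF grows_hexagon[OF hexagon_not_empty]] by auto

lemma energy_hexagon_le: "energy (hexagon L) \<le> \<epsilon> / 2 * (6 * u * real L - 6 * (real L)^2)"
proof -
  have "u * real (per (hexagon L)) \<le> u * real (6 * L)"
    using per_hexagon u_ge by (intro mult_left_mono) (simp_all only: of_nat_le_iff)
  then have "\<epsilon> / 2 * (u * real (per (hexagon L)) - real (card (hexagon L))) \<le> \<epsilon> / 2 * (6 * u * real L - 6 * (real L)^2)"
    using \<epsilon>_pos by (intro mult_left_mono) (simp_all add: card_hexagon)
  then show ?thesis using energy_u[of "hexagon L"] by simp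
qed

lemma energy_hexagon_neg: "energy (hexagon L) < 0"
proof -
  have "6 * u * real L - 6 * (real L)^2 = 6 * real L * (u - real L)"
    by (simp add: power2_eq_square algebra_simps)
  also have "\<dots> < 0" using u_less_L L_pos by (simp add: mult_pos_neg)
  finally have "\<epsilon> / 2 * (6 * u * real L - 6 * (real L)^2) < 0" using \<epsilon>_pos by (simp add: mult_pos_neg)
  then show ?thesis using energy_hexagon_le by linarith
qed

lemma energy_Int_hexagon: "S \<subseteq> Box L \<Longrightarrow> energy S = energy (S \<inter> hexagon L) + \<Delta> * real (card (S - hexagon L))"
  using card_Int_Diff[of S "hexagon L"] finite_subset_Box by (simp add: energy_def algebra_simps)

lemma isoperimetric_real: "finite S \<Longrightarrow> 6 * real (card S) \<le> (real (per S))^2"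
proof -
  assume "finite S"
  then have "real_of_int (6 * int (card S)) \<le> real_of_int (int (per S)^2)"
    using isoperimetric by (simp only: of_int_le_iff)
  then show ?thesis by simp
qed

lemma energy_hexagon_less:
  assumes S: "S \<subseteq> Box L" "S \<noteq> hexagon L"
  shows "energy (hexagon L) < energy S"
proof -
  let ?C = "S \<inter> hexagon L"
  have \<Delta>: "0 < \<Delta>" using U_pos U_less_\<Delta> by simp
  show ?thesis
  proof (cases "?C = hexagon L")
    case True
    then have "S - hexagon L \<noteq> {}" using S by auto
    then have "0 < card (S - hexagon L)" using finite_subset_Box[OF S(1)] by (simp add: card_gt_0_iff)
    then show ?thesis using energy_Int_hexagon[OF S(1)] \<Delta> True by simp
  next
    case False
    define m P where "m = real (card ?C)" and "P = real (per ?C)"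
    have "card ?C < card (hexagon L)" using False by (intro psubset_card_mono) auto
    then have "real (card ?C) < real (6 * L^2)" unfolding card_hexagon by (simp only: of_nat_less_iff)
    then have m: "m < 6 * (real L)^2" by (simp add: m_def)
    have iso: "6 * m \<le> P^2" using isoperimetric_real[of ?C] by (simp add: m_def P_def)
    have "6 * u * real L - 6 * (real L)^2 < u * P - m"
    proof (cases "6 * real L \<le> P")
      case True
      then have "u * (6 * real L) \<le> u * P" using u_ge by (intro mult_left_mono) auto
      then show ?thesis using m by simp
    next
      case False
      have "0 \<le> P" by (simp add: P_def)
      \<comment> \<open>This compares the parabola \<open>u * x - x^2 / 6\<close> at
        \<open>x = P\<close> and at \<open>x = 6 * L\<close>; its value at \<open>P\<close> bounds
        the scaled energy from below by the isoperimetric inequality.\<close>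
      then have "0 < (6 * real L - P) * (6 * real L + P - 6 * u)"
        using False u_less_L by (intro mult_pos_pos) auto
      then have "36 * (u * real L) - 36 * (real L)^2 < 6 * (u * P) - P^2"
        by (simp add: algebra_simps power2_eq_square)
      then show ?thesis using iso by simp
    qed
    then have "\<epsilon> / 2 * (6 * u * real L - 6 * (real L)^2) < \<epsilon> / 2 * (u * P - m)"
      using \<epsilon>_pos by (intro mult_strict_left_mono) auto
    also have "\<dots> = energy ?C" by (simp add: energy_u m_def P_def)
    also have "energy ?C \<le> energy S" using energy_Int_hexagon[OF S(1)] \<Delta> by simp
    finally show ?thesis using energy_hexagon_le by simp
  qed
qed

end

context critical_gas
begin

subsection \<open>Growing hexagons below the barrier\<close>

lemma bar_stage:
  assumes B: "grows x R (B 0)" "turn R B" "B 6 \<subseteq> hexagon L" and i: "i < 6"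
    and f: "alongside (B i) (bar_length R i) f" "B (Suc i) = B i \<union> f ` {..<bar_length R i}"
    and j: "j \<le> bar_length R i"
  defines "A \<equiv> B i \<union> f ` {..<j}"
  shows "A \<subseteq> hexagon L" "B 0 \<subseteq> A" "energy A + \<Delta> \<le> \<Gamma>" "per A \<le> 6 * R + 7" "6 * R^2 \<le> card A"
proof -
  note B0 = grows_props[OF B(1)]
  have R: "R \<ge> 1" and fin0: "finite (B 0)" using B0 by auto
  note Bi = turn_card_per[OF B(2) fin0 R less_imp_le[OF i]]
  have "A \<subseteq> B (Suc i)" using j f(2) by (auto simp: A_def)
  also have "\<dots> \<subseteq> hexagon L" using turn_mono[OF B(2) fin0 R, of "Suc i"] i B(3) by auto
  finally show sub: "A \<subseteq> hexagon L" .
  show "B 0 \<subseteq> A" using Bi by (auto simp: A_def)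
  define s :: nat where "s = (if j = 0 then 0 else if odd j then 1 else 2)"
  have card: "card A = 6 * R^2 + bars_total R i + j"
    using alongside_partial(1)[OF f(1) _ j] Bi B0 by (simp add: A_def)
  have per: "per A \<le> 6 * R + i + s"
    using alongside_partial(2)[OF f(1) _ j] Bi B0 by (fastforce simp: A_def s_def)
  show "6 * R^2 \<le> card A" using card by simp
  have "s \<le> 2" by (simp add: s_def)
  then show "per A \<le> 6 * R + 7" using per i by linarith
  have "real (per A) \<le> real (6 * R + i + s)" using per by (simp only: of_nat_le_iff)
  then have "U / 2 * real (per A) \<le> U / 2 * (6 * real R + real i + real s)"
    using U_pos by (intro mult_left_mono) auto
  moreover have "real (card A) = 6 * (real R)^2 + real (bars_total R i) + real j" by (simp add: card)
  \<comment> \<open>The worst moment within a bar is \<open>j = 2\<close>: the perimeter surplus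
    never exceeds 2, and later faces only lower the energy.\<close>
  moreover have "U / 2 * real s - \<epsilon> / 2 * real j \<le> U / 2 * 2 - \<epsilon> / 2 * 2"
  proof -
    consider "j = 0" | "odd j" | "j \<ge> 2" "even j" by (cases "j = 0"; cases "j = 1") auto
    then show ?thesis
    proof cases
      case 1
      then show ?thesis using \<epsilon>_le U_pos by (simp add: s_def)
    next
      case 2
      then have "s = 1" "1 \<le> real j" using odd_pos[of j] by (auto simp: s_def)
      moreover from this have "\<epsilon> / 2 * 1 \<le> \<epsilon> / 2 * real j" using \<epsilon>_pos by (intro mult_left_mono) auto
      ultimately show ?thesis using \<epsilon>_le U_pos by simp
    next
      case 3
      then have "s = 2" "2 \<le> real j" by (auto simp: s_def)
      moreover from this have "\<epsilon> / 2 * 2 \<le> \<epsilon> / 2 * real j" using \<epsilon>_pos by (intro mult_left_mono) auto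
      ultimately show ?thesis by simp
    qed
  qed
  ultimately have "energy A \<le> U / 2 * (6 * real R + real i + 2) - \<epsilon> / 2 * (6 * (real R)^2 + real (bars_total R i) + 2)"
    unfolding energy_per[OF sub] by (simp add: distrib_left)
  then show "energy A + \<Delta> \<le> \<Gamma>" using barrier_le[OF R i] by linarith
qed

text \<open>
  A nonempty part of a growing cluster has energy at least \<open>\<Delta>\<close>, unless it is so large that the
  energy of the cluster exceeds it only by a few bonds.
\<close>

lemma energy_gap:
  assumes A: "A \<subseteq> hexagon L" "energy A + \<Delta> \<le> \<Gamma>" "per A \<le> 6 * R + 7" "6 * R^2 \<le> card A"
    and C: "C \<subseteq> A" "C \<noteq> {}"
  shows "energy A - energy C \<le> \<Gamma> - 2 * \<Delta>"
proof (cases "\<Delta> \<le> energy C")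
  case True
  then show ?thesis using A by simp
next
  case False
  have C_sub: "C \<subseteq> hexagon L" and finA: "finite A" using A C finite_subset_hexagon by auto
  then have finC: "finite C" using C finite_subset by blast
  define p where "p = real (per C)"
  have EC: "energy C = U / 2 * p - \<epsilon> / 2 * real (card C)" by (simp add: energy_per[OF C_sub] p_def)
  have iso: "6 * real (card C) \<le> p^2" using isoperimetric_real[OF finC] by (simp add: p_def)
  have "\<epsilon> / 12 * (6 * real (card C)) \<le> \<epsilon> / 12 * p^2" using iso \<epsilon>_pos by (intro mult_left_mono) auto
  then have EC_ge: "U / 2 * p - \<epsilon> / 12 * p^2 \<le> energy C" using EC by simp
  have card_pos: "1 \<le> card C" using C finC by (simp add: Suc_le_eq card_gt_0_iff)
  \<comment> \<open>Perimeter at most 3 forces a single face, whose energy is exactly \<Delta>,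
    contrary to the case at hand.\<close>
  have "per C \<ge> 4"
  proof (rule ccontr)
    assume "\<not> per C \<ge> 4"
    then have "per C \<in> {0, 1, 2, 3}" by auto
    moreover have "6 * int (card C) \<le> int (per C)^2" by (rule isoperimetric[OF finC])
    ultimately have "per C = 3" "card C = 1" using card_pos by auto
    then have "energy C = \<Delta>" using EC by (simp add: p_def \<epsilon>_def field_simps)
    then show False using False by simp
  qed
  then have p4: "4 \<le> p" by (simp add: p_def)
  \<comment> \<open>The parabola U / 2 * p - \<epsilon> / 12 * p^2 is symmetric about 3 U /
    \<epsilon>. Between 4 and 6 U / \<epsilon> - 4 it is at least its value 2 U - 4 / 3 * \<epsilon>
    at 4, which is at least \<Delta>; so \<open>p\<close> must lie beyond.\<close>
  have far: "6 * U < \<epsilon> * (p + 4)"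
  proof (rule ccontr)
    assume "\<not> 6 * U < \<epsilon> * (p + 4)"
    then have "0 \<le> (p - 4) * (6 * U - \<epsilon> * (p + 4))" using p4 by (intro mult_nonneg_nonneg) auto
    then have "12 * (2 * U - 4 / 3 * \<epsilon>) \<le> 12 * (U / 2 * p - \<epsilon> / 12 * p^2)"
      by (simp add: algebra_simps power2_eq_square)
    then have "2 * U - 4 / 3 * \<epsilon> \<le> U / 2 * p - \<epsilon> / 12 * p^2" by (rule mult_left_le_imp_le) simp
    moreover have "\<Delta> \<le> 2 * U - 4 / 3 * \<epsilon>" using \<epsilon>_le U_pos \<Delta>_less by linarith
    ultimately show False using False EC_ge by linarith
  qed
  \<comment> \<open>If \<open>p\<close> is at least \<open>6 * R\<close>, then \<open>A\<close> has
    at most seven more sides and no fewer faces than \<open>C\<close>. Otherwise the parabola is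
    lower at \<open>6 * R\<close> than at \<open>p\<close>, and \<open>A\<close> again exceeds it by
    at most seven sides, at U / 2 each.\<close>
  have "energy A - energy C \<le> 7 / 2 * U"
  proof (cases "6 * real R \<le> p")
    case True
    have "real (per A) \<le> real (6 * R + 7)" using A(3) by (simp only: of_nat_le_iff)
    then have "real (per A) \<le> p + 7" using True by simp
    then have "U / 2 * real (per A) \<le> U / 2 * (p + 7)" using U_pos by (intro mult_left_mono) auto
    moreover have "real (card C) \<le> real (card A)" using card_mono[OF finA C(1)] by simp
    then have "\<epsilon> / 2 * real (card C) \<le> \<epsilon> / 2 * real (card A)" using \<epsilon>_pos by (intro mult_left_mono) auto
    ultimately show ?thesis unfolding energy_per[OF A(1)] EC by (simp add: distrib_left)
  next
    case False
    define q where "q = 6 * real R"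
    have pq: "p < q" using False by (simp add: q_def)
    have "\<epsilon> * (p + 4) \<le> \<epsilon> * (p + q)" using pq p4 \<epsilon>_pos by (intro mult_left_mono) auto
    then have "0 \<le> (q - p) * (\<epsilon> * (p + q) - 6 * U)" using far pq by (intro mult_nonneg_nonneg) auto
    then have "12 * (U / 2 * q - \<epsilon> / 12 * q^2) \<le> 12 * (U / 2 * p - \<epsilon> / 12 * p^2)"
      by (simp add: algebra_simps power2_eq_square)
    moreover have "real (per A) \<le> real (6 * R + 7)" using A(3) by (simp only: of_nat_le_iff)
    then have "U / 2 * real (per A) \<le> U / 2 * (q + 7)" using U_pos by (intro mult_left_mono) (auto simp: q_def)
    moreover have "real (6 * R^2) \<le> real (card A)" using A(4) by (simp only: of_nat_le_iff)
    then have "\<epsilon> / 2 * (q^2 / 6) \<le> \<epsilon> / 2 * real (card A)"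
      using \<epsilon>_pos by (intro mult_left_mono) (auto simp: q_def power_mult_distrib)
    ultimately show ?thesis using EC_ge unfolding energy_per[OF A(1)] by (simp add: distrib_left)
  qed
  then show ?thesis using Gamma_ge U_pos \<Delta>_less by linarith
qed

lemma reach_turn:
  assumes B: "grows x R (B 0)" "turn R B" "B 6 \<subseteq> hexagon L"
  shows "reach \<Gamma> (B 0) (B 6)"
    and "S \<subseteq> hexagon L \<Longrightarrow> x \<in> S \<Longrightarrow> reach (energy S + \<Gamma> - \<Delta> + U) (S \<union> B 0) (S \<union> B 6)"
proof -
  have bar: "\<exists>f. alongside (B i) (bar_length R i) f \<and> B (Suc i) = B i \<union> f ` {..<bar_length R i}" if "i < 6" for i
    using B(2) that unfolding turn_def bar_def by blast
  have "reach \<Gamma> (B 0) (B i)" if "i \<le> 6" for i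
    using that
  proof (induction i)
    case (Suc i)
    then obtain f where f: "alongside (B i) (bar_length R i) f" "B (Suc i) = B i \<union> f ` {..<bar_length R i}"
      using bar[of i] by auto
    have i: "i < 6" using Suc.prems by simp
    note stage = bar_stage[OF B i f]
    have "reach \<Gamma> (B i) (B i \<union> f ` {..<bar_length R i})"
      using stage(1)[OF order_refl] stage(3) by (intro reach_bar[OF f(1)]) auto
    then show ?case using Suc f(2) reach_trans by auto
  qed simp
  then show "reach \<Gamma> (B 0) (B 6)" by simp
  assume S: "S \<subseteq> hexagon L" "x \<in> S"
  let ?h = "energy S + \<Gamma> - \<Delta> + U"
  have "reach ?h (S \<union> B 0) (S \<union> B i)" if "i \<le> 6" for i
    using that
  proof (induction i)
    case (Suc i)
    then obtain f where f: "alongside (B i) (bar_length R i) f" "B (Suc i) = B i \<union> f ` {..<bar_length R i}"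
      using bar[of i] by auto
    have i: "i < 6" using Suc.prems by simp
    note stage = bar_stage[OF B i f]
    have "reach ?h (S \<union> B i) (S \<union> (B i \<union> f ` {..<bar_length R i}))"
    proof (rule reach_bar_Un[OF S(1) stage(1)[OF order_refl]])
      fix j assume "j < bar_length R i"
      then have j: "j \<le> bar_length R i" by simp
      let ?A = "B i \<union> f ` {..<j}"
      have "x \<in> ?A" using stage(2)[OF j] grows_props[OF B(1)] by auto
      then have "energy ?A - energy (S \<inter> ?A) \<le> \<Gamma> - 2 * \<Delta>"
        using S(2) stage[OF j] by (intro energy_gap[of _ R]) auto
      moreover have "energy (S \<union> ?A) + energy (S \<inter> ?A) \<le> energy S + energy ?A"
        using S(1) stage(1)[OF j] by (rule energy_submodular)
      ultimately show "energy (S \<union> ?A) + \<Delta> + U \<le> ?h" by linarith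
    qed
    then show ?case using Suc f(2) reach_trans by auto
  qed simp
  then show "reach ?h (S \<union> B 0) (S \<union> B 6)" by simp
qed

lemma reach_grows:
  assumes "grows x R K"
  shows "K \<subseteq> hexagon L \<Longrightarrow> reach \<Gamma> {} K"
    and "K \<subseteq> hexagon L \<Longrightarrow> S \<subseteq> hexagon L \<Longrightarrow> x \<in> S \<Longrightarrow> reach (energy S + \<Gamma> - \<Delta> + U) S (S \<union> K)"
  using assms
proof induction
  case (grows_1 p q)
  \<comment> \<open>Six particles already attached, one in transit and U < \<Delta> for obstacles
    make up 8 \<Delta>.\<close>
  have *: "8 * \<Delta> \<le> \<Gamma>" using Gamma_ge U_pos \<Delta>_less by linarith
  {
    case 1
    then show ?case using reach_add_set[of "Hex 1 p q" "{}" \<Gamma>] card_Hex_1[of p q] * U_pos U_less_\<Delta> by simp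
  next
    case 2
    then show ?case
      using reach_add_set[of "Hex 1 p q" S "energy S + \<Gamma> - \<Delta> + U"] card_Hex_1[of p q] * by simp
  }
next
  case (grows_Suc R B)
  have "B 0 \<subseteq> B 6"
    using grows_props[OF grows_Suc.hyps(1)] turn_card_per[OF grows_Suc.hyps(2), of 6] by auto
  {
    case 1
    have "reach \<Gamma> {} (B 0)" using grows_Suc.IH(1) 1 \<open>B 0 \<subseteq> B 6\<close> by blast
    then show ?case using reach_turn(1)[OF grows_Suc.hyps 1] by (rule reach_trans)
  next
    case 2
    have "reach (energy S + \<Gamma> - \<Delta> + U) S (S \<union> B 0)"
      using grows_Suc.IH(2) 2 \<open>B 0 \<subseteq> B 6\<close> by blast
    then show ?case using reach_turn(2)[OF grows_Suc.hyps 2] by (rule reach_trans)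
  }
qed

subsection \<open>Stability levels\<close>

context
  fixes \<beta> :: real
begin

abbreviation "X \<equiv> configs L"
abbreviation "P \<equiv> kawasaki L U \<Delta> \<beta>"
abbreviation "H \<equiv> hamiltonian L U \<Delta>"

lemma lower_energy_eq:
  assumes "S \<subseteq> Box L"
  shows "lower_energy X H (conf L S) = conf L ` {T. T \<subseteq> Box L \<and> energy T < energy S}"
  using assms by (auto simp: lower_energy_def configs_eq hamiltonian_energy)

lemma comm_height_empty_ge:
  assumes T: "T \<subseteq> Box L" "crit_card < int (card T)"
  shows "\<Gamma> \<le> comm_height X P H (conf L {}) (conf L T)"
proof (rule comm_height_ge)
  obtain h where "reach h {} T" using exists_reach[OF T(1)] by blast
  then have "reach (max h 0) {} T" using reach_mono by (meson max.cobounded1)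
  then show "paths X P (conf L {}) (conf L T) \<noteq> {}" using reach_path[of "max h 0" "{}" T \<beta>] by auto
next
  fix \<omega> assume "\<omega> \<in> paths X P (conf L {}) (conf L T)"
  then have "\<exists>\<zeta>\<in>set \<omega>. (\<Gamma> - \<Delta>) + \<Delta> \<le> H \<zeta>"
    using T crit_card_pos energy_ge_at_crit_card
    by (intro path_crossing[of \<beta> \<omega> "{}" "nat crit_card" T]) (auto simp: paths_def)
  then show "\<exists>\<zeta>\<in>set \<omega>. \<Gamma> \<le> H \<zeta>" by simp
qed simp

lemma crit_card_less_if_neg:
  assumes "T \<subseteq> Box L" "energy T < 0"
  shows "crit_card < int (card T)"
  using energy_nonneg_upto_crit_card[OF assms(1)] assms(2) by linarith

lemma comm_height_empty_full: "comm_height X P H (conf L {}) (conf L (hexagon L)) = \<Gamma>"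
proof (rule antisym)
  have "reach \<Gamma> {} (hexagon L)"
    using reach_grows(1)[OF grows_hexagon[OF hexagon_not_empty]] by simp
  then show "comm_height X P H (conf L {}) (conf L (hexagon L)) \<le> \<Gamma>"
    using Gamma_ge U_pos by (intro comm_height_le_of_reach) auto
  show "\<Gamma> \<le> comm_height X P H (conf L {}) (conf L (hexagon L))"
    using hexagon_subset_Box energy_hexagon_neg crit_card_less_if_neg by (intro comm_height_empty_ge) auto
qed

lemma stability_level_empty: "stability_level X P H (conf L {}) = ereal \<Gamma>"
proof -
  let ?I = "lower_energy X H (conf L {})"
  have I: "?I = conf L ` {T. T \<subseteq> Box L \<and> energy T < 0}" by (simp add: lower_energy_eq)
  have full: "conf L (hexagon L) \<in> ?I" using I hexagon_subset_Box energy_hexagon_neg by auto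
  have fin: "finite ?I" by (simp add: lower_energy_def)
  have "comm_height_set X P H (conf L {}) ?I = \<Gamma>"
    unfolding comm_height_set_def
  proof (rule Min_eqI)
    show "\<Gamma> \<in> comm_height X P H (conf L {}) ` ?I" using full comm_height_empty_full by force
    show "\<Gamma> \<le> y" if "y \<in> comm_height X P H (conf L {}) ` ?I" for y
      using that I comm_height_empty_ge crit_card_less_if_neg by auto
  qed (use fin in simp)
  then show ?thesis using full by (auto simp: stability_level_def hamiltonian_energy)
qed

lemma stability_level_less:
  assumes "S \<subseteq> Box L" "T \<subseteq> Box L" "energy T < energy S" "reach h S T" "energy S \<le> h" "h < energy S + \<Gamma>"
  shows "stability_level X P H (conf L S) < ereal \<Gamma>"
proof -
  let ?I = "lower_energy X H (conf L S)"
  have T: "conf L T \<in> ?I" using assms by (auto simp: lower_energy_eq)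
  have "finite ?I" by (simp add: lower_energy_def)
  then have "comm_height_set X P H (conf L S) ?I \<le> comm_height X P H (conf L S) (conf L T)"
    unfolding comm_height_set_def using T by (intro Min_le) auto
  also have "\<dots> \<le> h" using assms by (intro comm_height_le_of_reach) auto
  finally show ?thesis using T assms by (auto simp: stability_level_def hamiltonian_energy)
qed

lemma stability_level_other:
  assumes S: "S \<subseteq> Box L" "S \<noteq> {}" "S \<noteq> hexagon L"
  shows "stability_level X P H (conf L S) < ereal \<Gamma>"
proof (cases "S \<subseteq> hexagon L")
  case False
  then obtain x where x: "x \<in> S" "x \<notin> hexagon L" by blast
  \<comment> \<open>A particle outside the hexagon has no bonds, so its annihilation is a downhill
    move by \<Delta>.\<close>
  let ?T = "S - {x}"
  have "energy (insert x ?T) = energy ?T + \<Delta>"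
    using x finite_subset_Box[OF S(1)] by (intro energy_insert_outside) auto
  then have less: "energy ?T < energy S" using x U_pos U_less_\<Delta> by (simp add: insert_absorb)
  have "moves L S ?T" using x S(1) unfolding moves_def Box_bd_eq by blast
  then have "reach (energy S) S ?T" using less S(1) by (intro reach_step) auto
  then show ?thesis using S less Gamma_ge U_pos by (intro stability_level_less[of S ?T "energy S"]) auto
next
  case True
  obtain x where x: "x \<in> S" using S(2) by blast
  have "reach (energy S + \<Gamma> - \<Delta> + U) S (S \<union> hexagon L)"
    using reach_grows(2)[OF grows_hexagon] x True by blast
  moreover have "S \<union> hexagon L = hexagon L" using True by blast
  ultimately show ?thesis
    using S energy_hexagon_less[OF S(1,3)] hexagon_subset_Box Gamma_ge U_pos U_less_\<Delta> \<Delta>_less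
    by (intro stability_level_less[of S "hexagon L" "energy S + \<Gamma> - \<Delta> + U"]) auto
qed

lemma energy_hexagon_min: "T \<subseteq> Box L \<Longrightarrow> energy (hexagon L) \<le> energy T"
  using energy_hexagon_less[of T] by (cases "T = hexagon L") auto

lemma stable_states_eq: "stable_states X H = {conf L (hexagon L)}"
proof -
  have full: "conf L (hexagon L) \<in> X" using hexagon_subset_Box by (auto simp: configs_eq)
  have "H (conf L (hexagon L)) \<le> H \<eta>" if \<eta>: "\<eta> \<in> X" for \<eta>
  proof -
    obtain T where "\<eta> = conf L T" "T \<subseteq> Box L" using \<eta> by (auto simp: configs_eq)
    then show ?thesis using energy_hexagon_min[of T] by (simp add: hamiltonian_energy hexagon_subset_Box)
  qed
  moreover have "\<sigma> = conf L (hexagon L)" if \<sigma>: "\<sigma> \<in> X" "H \<sigma> \<le> H (conf L (hexagon L))" for \<sigma>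
  proof -
    obtain S where S: "\<sigma> = conf L S" "S \<subseteq> Box L" using \<sigma>(1) by (auto simp: configs_eq)
    then have "energy S \<le> energy (hexagon L)" using \<sigma>(2) by (simp add: hamiltonian_energy hexagon_subset_Box)
    then show ?thesis using energy_hexagon_less[OF S(2)] S(1) by (cases "S = hexagon L") auto
  qed
  ultimately show ?thesis using full unfolding stable_states_def by blast
qed

text \<open>The metastable states are selected from all configurations, so the stable one is
  excluded by its infinite level.\<close>

lemma stability_level_full: "stability_level X P H (conf L (hexagon L)) = \<infinity>"
proof -
  have "\<not> energy T < energy (hexagon L)" if "T \<subseteq> Box L" for T
    using energy_hexagon_min[OF that] by simp
  then have "{T. T \<subseteq> Box L \<and> energy T < energy (hexagon L)} = {}" by blast
  then show ?thesis
    unfolding stability_level_def lower_energy_eq[OF hexagon_subset_Box] by simp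
qed

lemma metastable_states_eq: "metastable_states X P H = {conf L {}}"
proof -
  let ?V = "stability_level X P H"
  have "conf L {} \<noteq> conf L (hexagon L)"
  proof
    assume "conf L {} = conf L (hexagon L)"
    then have "ereal \<Gamma> = \<infinity>" using stability_level_empty stability_level_full by metis
    then show False by simp
  qed
  moreover have "conf L {} \<in> X" unfolding configs_eq by blast
  ultimately have empty: "conf L {} \<in> X - stable_states X H" unfolding stable_states_eq by blast
  have "Max (?V ` (X - stable_states X H)) = ereal \<Gamma>"
  proof (rule Max_eqI)
    show "ereal \<Gamma> \<in> ?V ` (X - stable_states X H)" using empty stability_level_empty by force
    show "y \<le> ereal \<Gamma>" if y: "y \<in> ?V ` (X - stable_states X H)" for y
    proof -
      obtain \<sigma> where \<sigma>: "\<sigma> \<in> X" "\<sigma> \<noteq> conf L (hexagon L)" "y = ?V \<sigma>"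
        using y unfolding stable_states_eq by blast
      then obtain S where S: "S \<subseteq> Box L" "\<sigma> = conf L S" by (auto simp: configs_eq)
      then have "S \<noteq> hexagon L" using \<sigma>(2) by blast
      then show ?thesis using stability_level_other[OF S(1)] stability_level_empty
        unfolding \<sigma>(3) S(2) by (cases "S = {}") auto
    qed
  qed simp
  then have "metastable_states X P H = {\<sigma> \<in> X. ?V \<sigma> = ereal \<Gamma>}" by (simp add: metastable_states_def)
  moreover have "S = {}" if "S \<subseteq> Box L" "?V (conf L S) = ereal \<Gamma>" for S
    using stability_level_other[OF that(1)] stability_level_full that(2)
    by (cases "S = {}"; cases "S = hexagon L") auto
  ultimately show ?thesis using stability_level_empty empty by (auto simp: configs_eq)
qed

lemma metastable_level_eq: "metastable_level X P H = ereal \<Gamma>"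
  by (simp add: metastable_level_def metastable_states_eq stability_level_empty)

end

end

theorem theorem2p2:
  fixes L :: nat and U \<Delta> \<beta> :: real
  assumes "L \<ge> 1"
    and "\<beta> > 0"
    and "U > 0"
    and "U < \<Delta>" and "\<Delta> < 3 / 2 * U"
    and "3 * U - 2 * \<Delta> \<le> U / 100"
    and "crit_ratio U \<Delta> \<notin> \<int>"
    and "crit_frac U \<Delta> \<noteq> 1 / 2"
    and "int L > 2 * crit_radius U \<Delta> + 3"
  shows "metastable_states (configs L) (kawasaki L U \<Delta> \<beta>) (hamiltonian L U \<Delta>) = {config_empty L}
    \<and> stable_states (configs L) (hamiltonian L U \<Delta>) = {config_full L}
    \<and> metastable_level (configs L) (kawasaki L U \<Delta> \<beta>) (hamiltonian L U \<Delta>)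
        = ereal (comm_height (configs L) (kawasaki L U \<Delta> \<beta>) (hamiltonian L U \<Delta>)
                   (config_empty L) (config_full L))
    \<and> comm_height (configs L) (kawasaki L U \<Delta> \<beta>) (hamiltonian L U \<Delta>)
        (config_empty L) (config_full L) = Gamma_KHex U \<Delta>"
proof -
  interpret critical_gas L U \<Delta>
    using assms by unfold_locales auto
  show ?thesis
    unfolding config_empty_eq config_full_eq
    using metastable_states_eq stable_states_eq metastable_level_eq comm_height_empty_full by simp
qed

end
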